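(* In the standing setup, assume $A$ is generic and $\det f_0'(x)$ is not identically zero; write $f=f_0$. For $\varepsilon\in\mathbb R$ define $\Pi(x)=J-\varepsilon^2(f'(x))^2J$. Then (i) $\Pi(x)=(1-\varepsilon^2p_0(x))J-\varepsilon^2\sum_{i=1}^3q_i(x)B_i^{\rm T}J=(1-\varepsilon^2p(x))J-\varepsilon^2q(x)A^{\rm T}J-\varepsilon^2r(x)(A^{\rm T})^2J$, where $p=p_0+\sum_i\alpha_iq_i$, $q=\sum_i\beta_iq_i$, $r=\sum_i\gamma_iq_i$; (ii) $\Pi$ is a Poisson tensor on $\mathbb R^6$ (skew-symmetric and satisfying the Jacobi identity); (iii) the Kahan map $\Phi_f$ is Poisson with respect to $\Pi$: $d\Phi_f(x)\,\Pi(x)\,(d\Phi_f(x))^{\rm T}=\Pi(\Phi_f(x))$; (iv) for any vector field $g=B^{\rm T}f$ associated to $f$ (with $B=\alpha I+\beta A+\gamma A^2$, $B^2=I$), $\Phi_g$ is also Poisson with respect to the same $\Pi$.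
   Context: Standing setup: $J=\begin{pmatrix}0&I_3\\-I_3&0\end{pmatrix}$ ($6\times6$). $A$ is a fixed real $6\times 6$ skew-Hamiltonian matrix ($A^{\rm T}J=JA$). $H_0$ is a homogeneous cubic polynomial on $\mathbb R^6$ with $A\nabla^2H_0(x)=\nabla^2H_0(x)A^{\rm T}$ for all $x$ ($\nabla^2$ = Hesse matrix), $H_1,H_2$ homogeneous cubic polynomials with $\nabla H_1=A\nabla H_0$, $\nabla H_2=A\nabla H_1$, $f_i=J\nabla H_i$, primes denote Jacobi matrices. Genericity: the characteristic polynomial of $A$ (a square of a cubic) has three pairwise distinct roots $\lambda_1,\lambda_2,\lambda_3$, each a double eigenvalue. $B_i=\alpha_iI+\beta_iA+\gamma_iA^2$ ($i=1,2,3$), where $\alpha_i+\beta_i\lambda+\gamma_i\lambda^2$ is the unique polynomial of degree $\le2$ equal to $-1$ at $\lambda_i$ and to $1$ at the other two eigenvalues. $p_0(x)=\tfrac18\operatorname{tr}(f_0'(x))^2$, $q_i(x)=\tfrac18\operatorname{tr}(B_i^{\rm T}(f_0'(x))^2)$. Kahan map of a homogeneous quadratic vector field $h$: $\Phi_h(x)=(I-\varepsilon h'(x))^{-1}x$; $d\Phi_h$ is its Jacobi matrix. A matrix-valued function $\Pi$ is a Poisson tensor if the bracket $\{F,G\}=(\nabla F)^{\rm T}\Pi\nabla G$ is skew-symmetric and satisfies the Jacobi identity. *)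

theory Defs
  imports "HOL-Analysis.Analysis"
begin

text \<open>Vectors in R^6 are \<open>real^6\<close>; 6x6 matrices are \<open>real^6^6\<close>
  (indices of type \<open>6\<close> are 0,...,5).\<close>

definition Jmat :: "real^6^6" where
  "Jmat = (\<chi> i j. if i \<in> {0,1,2} \<and> j = i + 3 then 1
                   else if i \<in> {3,4,5} \<and> j = i - 3 then -1 else 0)"

definition cubic_form :: "(real^6 \<Rightarrow> real) \<Rightarrow> bool" where
  "cubic_form H \<longleftrightarrow> (\<exists>c :: 6 \<Rightarrow> 6 \<Rightarrow> 6 \<Rightarrow> real.
      \<forall>x. H x = (\<Sum>i\<in>UNIV. \<Sum>j\<in>UNIV. \<Sum>k\<in>UNIV. c i j k * x$i * x$j * x$k))"

definition Jac :: "(real^'n \<Rightarrow> real^'m) \<Rightarrow> real^'n \<Rightarrow> real^'n^'m" where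
  "Jac F x = matrix (frechet_derivative F (at x))"

definition grad :: "(real^'n \<Rightarrow> real) \<Rightarrow> real^'n \<Rightarrow> real^'n" where
  "grad H x = (\<chi> i. frechet_derivative H (at x) (axis i 1))"

definition hess :: "(real^'n \<Rightarrow> real) \<Rightarrow> real^'n \<Rightarrow> real^'n^'n" where
  "hess H x = Jac (grad H) x"

definition skew_hamiltonian :: "real^6^6 \<Rightarrow> bool" where
  "skew_hamiltonian A \<longleftrightarrow> transpose A ** Jmat = Jmat ** A"

text \<open>Kahan map of a (homogeneous quadratic) vector field h.\<close>
definition kahan :: "real \<Rightarrow> (real^'n \<Rightarrow> real^'n) \<Rightarrow> real^'n \<Rightarrow> real^'n" where
  "kahan \<epsilon> h x = matrix_inv (mat 1 - \<epsilon> *\<^sub>R Jac h x) *v x"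

definition pbr :: "(real^'n \<Rightarrow> real^'n^'n) \<Rightarrow> (real^'n \<Rightarrow> real) \<Rightarrow> (real^'n \<Rightarrow> real)
                   \<Rightarrow> real^'n \<Rightarrow> real" where
  "pbr P F G = (\<lambda>x. grad F x \<bullet> (P x *v grad G x))"

definition twice_diff :: "(real^'n \<Rightarrow> real) \<Rightarrow> bool" where
  "twice_diff F \<longleftrightarrow> (\<forall>x. F differentiable at x) \<and> (\<forall>x. grad F differentiable at x)"

definition poisson_tensor :: "(real^'n \<Rightarrow> real^'n^'n) \<Rightarrow> bool" where
  "poisson_tensor P \<longleftrightarrow>
     (\<forall>F G. (\<forall>x. F differentiable at x) \<longrightarrow> (\<forall>x. G differentiable at x) \<longrightarrow>
        pbr P F G = (\<lambda>x. - pbr P G F x)) \<and>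
     (\<forall>F G K. twice_diff F \<longrightarrow> twice_diff G \<longrightarrow> twice_diff K \<longrightarrow>
        (\<forall>x. pbr P F (pbr P G K) x + pbr P G (pbr P K F) x + pbr P K (pbr P F G) x = 0))"

definition cmat :: "real^'n^'m \<Rightarrow> complex^'n^'m" where
  "cmat M = (\<chi> i j. complex_of_real (M$i$j))"

end

theory Submission
  imports Defs
begin

text \<open>
  Write \<open>M(x) = f'(x) = J S(x)\<close> and \<open>C = A\<^sup>T\<close>. Then \<open>M(x)\<close> commutes with \<open>C\<close>, and
  \<open>(C - \<lambda>\<^sub>i) J\<close> is skew-symmetric and singular, so its kernel has dimension at least two. Hence \<open>C\<close>
  is diagonalizable, and each spectral projection \<open>P\<^sub>i\<close> gives a skew-symmetric matrix
  \<open>W = P\<^sub>i J = p q\<^sup>T - q p\<^sup>T\<close> of rank two. For such a \<open>W\<close> and every skew-symmetric \<open>R\<close> one has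
  \<open>W R W = (tr(W R) / 2) W\<close>, which makes \<open>M(x)\<^sup>2\<close> a combination of the \<open>P\<^sub>i\<close>; since
  \<open>B\<^sub>i\<^sup>T = 1 - 2 P\<^sub>i\<close>, this is (i), and it shows that \<open>M(x)\<^sup>2\<close> commutes with every \<open>M(y)\<close>.
  The Kahan map satisfies \<open>(1 - \<epsilon> M(x)) d\<Phi>(x) = 1 + \<epsilon> M(\<Phi>(x))\<close>, and \<open>J M\<^sup>T = - M J\<close> turns (iii)
  and (iv) into a polynomial identity in \<open>M(x)\<close> and \<open>M(\<Phi>(x))\<close>. For the Jacobi identity,
  \<open>M(P\<^sub>i z) = P\<^sub>i M(z)\<close> reduces everything to the Pluecker relation for each \<open>W\<close>.
\<close>

section \<open>Matrix algebra\<close>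

text \<open>The factor has the type of the entries, so that complex eigenvalues can scale complex
  matrices; \<open>*\<^sub>R\<close> scales by reals.\<close>

definition scalar_matrix_mult :: "'a::times \<Rightarrow> 'a^'n^'m \<Rightarrow> 'a^'n^'m" (infixl "*k" 70)
  where "c *k A = (\<chi> i j. c * A$i$j)"

lemma matrix_add_rdistrib: "(A + B) ** C = A ** C + B ** C"
  for A B :: "'a::semiring_1^'n^'m"
  by (vector matrix_matrix_mult_def sum.distrib distrib_right)

lemma matrix_minus_left: "(- A) ** B = - (A ** B)" for A :: "'a::ring_1^'n^'m"
  by (vector matrix_matrix_mult_def sum_negf)

lemma matrix_minus_right: "A ** (- B) = - (A ** B)" for A :: "'a::ring_1^'n^'m"
  by (vector matrix_matrix_mult_def sum_negf)

lemma matrix_diff_ldistrib: "A ** (B - C) = A ** B - A ** C" for A :: "'a::ring_1^'n^'m"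
  by (metis diff_conv_add_uminus matrix_add_ldistrib matrix_minus_right)

lemma matrix_diff_rdistrib: "(A - B) ** C = A ** C - B ** C" for A :: "'a::ring_1^'n^'m"
  by (metis diff_conv_add_uminus matrix_add_rdistrib matrix_minus_left)

lemma matrix_scalar_left: "(c *k A) ** B = c *k (A ** B)" for A :: "'a::comm_ring_1^'n^'m"
  by (vector scalar_matrix_mult_def matrix_matrix_mult_def sum_distrib_left mult.assoc)

lemma matrix_scalar_right: "A ** (c *k B) = c *k (A ** B)" for A :: "'a::comm_ring_1^'n^'m"
  by (vector scalar_matrix_mult_def matrix_matrix_mult_def sum_distrib_left mult.left_commute)

lemma matrix_scaleR_left: "(c *\<^sub>R A) ** B = c *\<^sub>R (A ** B)" for A :: "real^'n^'m"
  by (vector matrix_matrix_mult_def sum_distrib_left mult.assoc)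

lemma matrix_scaleR_right: "A ** (c *\<^sub>R B) = c *\<^sub>R (A ** B)" for A :: "real^'n^'m"
  by (vector matrix_matrix_mult_def sum_distrib_left mult.left_commute)

lemma mat_eq_scalar: "mat c = c *k mat 1" for c :: "'a::comm_ring_1"
  by (vector scalar_matrix_mult_def mat_def)

lemma mat_mul_left: "mat c ** A = c *k A" for A :: "'a::comm_ring_1^'n^'m"
  by (subst mat_eq_scalar) (simp add: matrix_scalar_left)

lemma scalar_matrix_simps:
  fixes A B :: "'a::comm_ring_1^'n^'m"
  shows "c *k (d *k A) = (c * d) *k A" "c *k (A + B) = c *k A + c *k B"
    "c *k (A - B) = c *k A - c *k B" "c *k (- A) = - (c *k A)" "(- c) *k A = - (c *k A)"
    "(c + d) *k A = c *k A + d *k A" "(c - d) *k A = c *k A - d *k A"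
    "1 *k A = A" "0 *k A = 0" "c *k (0::'a^'n^'m) = 0"
  by (vector scalar_matrix_mult_def algebra_simps)+

lemma transpose_simps:
  "transpose (A + B) = transpose A + transpose B"
  "transpose (A - B) = transpose A - transpose B"
  "transpose (- A) = - transpose A"
  for A B :: "'a::ring_1^'n^'m"
  by (vector transpose_def)+

lemma transpose_scalar_mult: "transpose (c *k A) = c *k transpose A" for A :: "'a::comm_ring_1^'n^'m"
  by (vector scalar_matrix_mult_def transpose_def)

lemmas matrix_ring_simps = matrix_add_ldistrib matrix_add_rdistrib matrix_minus_left matrix_minus_right
  matrix_diff_ldistrib matrix_diff_rdistrib matrix_scalar_left matrix_scalar_right mat_mul_left
  scalar_matrix_simps transpose_simps transpose_scalar_mult matrix_mul_assoc matrix_transpose_mul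

lemma scalar_matrix_vector: "(c *k A) *v x = c *s (A *v x)" for A :: "'a::comm_ring_1^'n^'m"
  by (vector scalar_matrix_mult_def matrix_vector_mult_def sum_distrib_left mult.assoc)

lemma matrix_vector_minus: "(- A) *v x = - (A *v x)" for A :: "'a::comm_ring_1^'n^'m"
  by (vector matrix_vector_mult_def sum_negf)

lemma trace_scalar: "trace (c *k A) = c * trace A" for A :: "'a::comm_ring_1^'n^'n"
  by (simp add: trace_def scalar_matrix_mult_def sum_distrib_left)

section \<open>Singular and rank-two skew-symmetric matrices\<close>

lemma singular_matrix_kernel:
  fixes K :: "'a::field^'n^'n"
  assumes "det K = 0"
  obtains v where "v \<noteq> 0" "K *v v = 0"
  using assms invertible_det_nz[of K] invertible_left_inverse[of K] matrix_left_invertible_ker[of K]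
  by blast

text \<open>A skew-symmetric matrix has even rank, so in even size a singular one loses at least two
  dimensions. For a kernel vector \<open>u\<close> with \<open>u $ k\<close> nonzero, deleting row
  and column \<open>k\<close> leaves a skew matrix of odd size, hence a singular one; its kernel
  gives a second vector \<open>w\<close> with \<open>w $ k = 0\<close>.\<close>

lemma skew_even_kernel:
  fixes K :: "'a::field_char_0^'n^'n"
  assumes skew: "transpose K = - K" and ev: "even CARD('n)" and sing: "det K = 0"
  obtains u w where "K *v u = 0" "K *v w = 0" "\<And>a b. a *s u + b *s w = 0 \<Longrightarrow> a = 0 \<and> b = 0"
proof -
  obtain u where u: "u \<noteq> 0" "K *v u = 0" using singular_matrix_kernel[OF sing] by blast
  then obtain k where k: "u $ k \<noteq> 0" by (metis vec_eq_iff zero_index)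
  have sk: "K $ i $ j = - K $ j $ i" for i j
    using skew by (metis (no_types) transpose_def vec_lambda_beta vector_uminus_component)
  \<comment> \<open>Instead of changing the index type, row and column \<open>k\<close> are replaced
    by those of the identity. Transposing \<open>L\<close> then negates every row except row
    \<open>k\<close>, an odd number of rows, so \<open>det L = - det L\<close>.\<close>
  define L where "L = (\<chi> i j. if i = k \<or> j = k then (if i = j then 1 else 0) else K$i$j)"
  define D where "D = (\<chi> i j. if i = j then (if i = k then 1 else -1) else (0 :: 'a))"
  have DL: "transpose L = D ** L"
  proof -
    have "(D ** L) $ i $ j = (if i = k then 1 else -1) * L $ i $ j" for i j
      unfolding matrix_matrix_mult_def D_def
      by (simp add: if_distrib[where f="\<lambda>c. c * _"] sum.delta cong: if_cong)
    moreover have "transpose L $ i $ j = (if i = k then 1 else -1) * L $ i $ j" for i j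
      by (auto simp: L_def transpose_def sk[of j i])
    ultimately show ?thesis by (simp add: vec_eq_iff)
  qed
  have "det D = (\<Prod>i\<in>UNIV. if i = k then 1 else -1)"
    by (subst det_diagonal) (auto simp: D_def)
  also have "\<dots> = (\<Prod>i\<in>UNIV - {k}. -1)"
    by (subst prod.remove[of _ k]) (auto intro: prod.cong)
  also have "\<dots> = - 1" using ev by (simp add: card_Diff_singleton)
  finally have "det L = - det L" using arg_cong[OF DL, of det] by (simp add: det_mul)
  then have "det L = 0" by simp
  then obtain w where w: "w \<noteq> 0" "L *v w = 0" using singular_matrix_kernel by blast
  have row: "(\<Sum>j\<in>UNIV. L$i$j * w$j) = 0" for i
    using arg_cong[OF w(2), of "\<lambda>v. v $ i"] by (simp add: matrix_vector_mult_def)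
  have wk: "w $ k = 0"
    using row[of k] by (simp add: L_def if_distrib[where f="\<lambda>c. c * _"] sum.delta' cong: if_cong)
  have Kw: "(K *v w) $ i = 0" if "i \<noteq> k" for i
  proof -
    have "(K *v w) $ i = (\<Sum>j\<in>UNIV. L$i$j * w$j)"
      unfolding matrix_vector_mult_def using that wk by (auto simp: L_def intro!: sum.cong)
    then show ?thesis using row by simp
  qed
  \<comment> \<open>The entries of \<open>K *v w\<close> off \<open>k\<close> vanish by the choice
    of \<open>w\<close>. Pairing with \<open>u\<close> gives zero because \<open>K\<close> is skew
    and \<open>K *v u = 0\<close>; only the term at \<open>k\<close> survives, and
    \<open>u $ k\<close> is nonzero.\<close>
  have "(\<Sum>i\<in>UNIV. u$i * (K *v w)$i) = (\<Sum>i\<in>UNIV. \<Sum>j\<in>UNIV. u$i * (K$i$j * w$j))"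
    by (simp add: matrix_vector_mult_def sum_distrib_left)
  also have "\<dots> = (\<Sum>j\<in>UNIV. \<Sum>i\<in>UNIV. u$i * (K$i$j * w$j))" by (rule sum.swap)
  also have "\<dots> = (\<Sum>j\<in>UNIV. - (K *v u)$j * w$j)"
    unfolding matrix_vector_mult_def
    by (intro sum.cong refl) (subst sk, simp add: sum_distrib_left sum_negf mult_ac)
  finally have "(\<Sum>i\<in>UNIV. u$i * (K *v w)$i) = 0" using u by simp
  then have "u$k * (K *v w)$k = 0"
    by (subst (asm) sum.remove[of _ k]) (auto simp: Kw)
  then have "K *v w = 0" using k Kw by (metis mult_eq_0_iff vec_eq_iff zero_index)
  moreover have "a = 0 \<and> b = 0" if e: "a *s u + b *s w = 0" for a b
  proof -
    have "a = 0" using arg_cong[OF e, of "\<lambda>v. v$k"] wk k by simp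
    then show ?thesis using e w(1) by simp
  qed
  ultimately show thesis using that u(2) by blast
qed

text \<open>Columns in a common plane make all minors of size three vanish. At a nonzero entry
  \<open>W$r$s\<close> such a minor expresses \<open>W\<close> through its columns \<open>r\<close>
  and \<open>s\<close>, which become \<open>p\<close> (after division by \<open>W$r$s\<close>) and
  \<open>q\<close>. The zero diagonal is a separate assumption because the field may have
  characteristic two.\<close>

lemma skew_rank_two:
  fixes W :: "'a::field^'n^'n"
  assumes skew: "\<And>i j. W$i$j = - W$j$i" and diag: "\<And>i. W$i$i = 0"
    and cols: "\<And>i j. W$i$j = u$i * a$j + w$i * b$j"
  obtains p q where "\<And>i j. W$i$j = p$i * q$j - q$i * p$j"
proof (cases "W = 0")
  case True
  then show thesis by (intro that[of 0 0]) simp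
next
  case False
  then obtain r s where m: "W$r$s \<noteq> 0" by (metis vec_eq_iff zero_index)
  have main: "W$r$s * W$i$j = W$i$r * W$j$s - W$i$s * W$j$r" for i j
  proof -
    \<comment> \<open>the minor of rows \<open>r, s, i\<close> and columns \<open>r, s, j\<close> vanishes since all columns lie in a plane\<close>
    have "W$r$r * (W$s$s * W$i$j - W$s$j * W$i$s) - W$r$s * (W$s$r * W$i$j - W$s$j * W$i$r)
        + W$r$j * (W$s$r * W$i$s - W$s$s * W$i$r) = 0"
      unfolding cols by algebra
    then have "W$r$s * (W$r$s * W$i$j - (W$i$r * W$j$s - W$i$s * W$j$r)) = 0"
      unfolding diag skew[of s r] skew[of s j] skew[of r j] by (simp add: algebra_simps)
    then show ?thesis using m by simp
  qed
  show thesis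
    by (rule that[of "\<chi> i. W$i$r / W$r$s" "\<chi> i. W$i$s"])
      (use main m in \<open>simp add: divide_simps mult.commute\<close>)
qed

text \<open>Expanding \<open>W ** R ** W\<close> leaves the four values of the bilinear form
  \<open>F\<close> of \<open>R\<close> on \<open>p\<close> and \<open>q\<close>. As \<open>F\<close>
  is alternating, only \<open>F q p\<close> remains, multiplied by \<open>W\<close>; the trace of
  \<open>W ** R\<close> is \<open>2 * F q p\<close>.\<close>

lemma rank_two_sandwich:
  fixes W R :: "'a::field_char_0^'n^'n"
  assumes W: "\<And>i j. W$i$j = p$i * q$j - q$i * p$j" and R: "\<And>i j. R$i$j = - R$j$i"
  shows "W ** R ** W = (trace (W ** R) / 2) *k W"
proof -
  define F where "F x y = (\<Sum>i\<in>UNIV. \<Sum>j\<in>UNIV. x$i * R$i$j * y$j)" for x y :: "'a^'n"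
  have Fsk: "F x y = - F y x" for x y
  proof -
    have "F x y = (\<Sum>j\<in>UNIV. \<Sum>i\<in>UNIV. x$i * R$i$j * y$j)" unfolding F_def by (rule sum.swap)
    also have "\<dots> = - F y x" unfolding F_def by (subst R) (simp add: sum_negf mult_ac)
    finally show ?thesis .
  qed
  have F0: "F x x = 0" for x using Fsk[of x x] by simp
  have WRW: "(W ** R ** W) $ i $ j = (\<Sum>k\<in>UNIV. \<Sum>l\<in>UNIV. W$i$k * R$k$l * W$l$j)" for i j
    unfolding matrix_matrix_mult_def
    by (simp add: sum_distrib_right sum_distrib_left) (rule sum.swap)
  have 1: "(W ** R ** W) $ i $ j = p$i * q$j * F q p - p$i * p$j * F q q - q$i * q$j * F p p + q$i * p$j * F p q" for i j
    unfolding WRW F_def W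
    by (simp add: algebra_simps sum.distrib sum_subtractf sum_distrib_left)
  have "trace (W ** R) = (\<Sum>i\<in>UNIV. \<Sum>k\<in>UNIV. W$i$k * R$k$i)"
    by (simp add: trace_def matrix_matrix_mult_def)
  also have "\<dots> = F q p - F p q"
  proof -
    have "(\<Sum>i\<in>UNIV. \<Sum>k\<in>UNIV. W$i$k * R$k$i) = (\<Sum>i\<in>UNIV. \<Sum>k\<in>UNIV. W$k$i * R$i$k)"
      by (rule sum.swap)
    also have "\<dots> = F q p - F p q"
      unfolding W F_def by (simp add: algebra_simps sum_subtractf)
    finally show ?thesis by simp
  qed
  finally have "trace (W ** R) / 2 = F q p" using Fsk[of p q] by simp
  then show ?thesis using 1 F0 Fsk[of p q]
    by (simp add: vec_eq_iff scalar_matrix_mult_def W algebra_simps)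
qed

section \<open>The symplectic matrix on six indices\<close>

lemma UNIV_6: "(UNIV::6 set) = {0,1,2,3,4,5}"
  by (rule sym, rule card_subset_eq) auto

lemma sum_6: "sum f (UNIV::6 set) = f 0 + f 1 + f 2 + f 3 + f 4 + f 5"
  unfolding UNIV_6 by (simp add: add.assoc)

lemma forall_6: "(\<forall>i::6. P i) \<longleftrightarrow> P 0 \<and> P 1 \<and> P 2 \<and> P 3 \<and> P 4 \<and> P 5"
  by (metis UNIV_6 UNIV_I insertE singletonD)

lemma transpose_Jmat: "transpose Jmat = - Jmat"
  by (simp add: vec_eq_iff transpose_def Jmat_def forall_6)

lemma Jmat_squared: "Jmat ** Jmat = - mat 1"
  by (simp add: vec_eq_iff matrix_matrix_mult_def mat_def Jmat_def forall_6 sum_6)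

section \<open>Gradients, Hessians and the Jacobi identity\<close>

lemma grad_has_derivative:
  fixes F :: "real^'n \<Rightarrow> real"
  assumes "F differentiable at x"
  shows "(F has_derivative (\<lambda>h. grad F x \<bullet> h)) (at x)"
proof -
  let ?D = "frechet_derivative F (at x)"
  have D: "(F has_derivative ?D) (at x)" using assms frechet_derivative_works by blast
  then have lin: "linear ?D" by (rule has_derivative_linear)
  have "?D h = grad F x \<bullet> h" for h
  proof -
    have "?D h = ?D (\<Sum>i\<in>UNIV. h $ i *\<^sub>R axis i 1)"
      by (simp add: basis_expansion scalar_mult_eq_scaleR[symmetric])
    also have "\<dots> = (\<Sum>i\<in>UNIV. h $ i * ?D (axis i 1))"
      using lin by (simp add: linear_sum linear_cmul)
    finally show ?thesis by (simp add: inner_vec_def grad_def mult.commute)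
  qed
  then have "?D = (\<lambda>h. grad F x \<bullet> h)" by blast
  with D show ?thesis by simp
qed

lemma grad_eqI:
  fixes F :: "real^'n \<Rightarrow> real"
  assumes "(F has_derivative (\<lambda>h. g \<bullet> h)) (at x)"
  shows "grad F x = g"
  unfolding grad_def frechet_derivative_at[OF assms, symmetric] by (simp add: vec_eq_iff inner_axis)

lemma Jac_has_derivative:
  fixes F :: "real^'n \<Rightarrow> real^'m"
  assumes "F differentiable at x"
  shows "(F has_derivative (\<lambda>h. Jac F x *v h)) (at x)"
proof -
  have "(F has_derivative frechet_derivative F (at x)) (at x)"
    using assms frechet_derivative_works by blast
  moreover from this have "linear (frechet_derivative F (at x))" by (rule has_derivative_linear)
  ultimately show ?thesis
    unfolding Jac_def by (simp add: matrix_works)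
qed

lemma Jac_eqI:
  fixes F :: "real^'n \<Rightarrow> real^'m"
  assumes "(F has_derivative (\<lambda>h. M *v h)) (at x)"
  shows "Jac F x = M"
  unfolding Jac_def frechet_derivative_at[OF assms, symmetric] by simp

text \<open>The mean value theorem along \<open>u\<close>, applied to the increment of
  \<open>F\<close> in direction \<open>v\<close>, turns the second difference into a difference of
  two values of \<open>G\<close>. Both are compared with the linearization of \<open>G\<close> at
  \<open>x\<close>, so differentiability of \<open>G\<close> at that single point suffices.\<close>

lemma second_difference_bound:
  fixes F :: "real^'n \<Rightarrow> real" and G :: "real^'n \<Rightarrow> real^'n"
  assumes F: "\<And>y. (F has_derivative (\<lambda>h. G y \<bullet> h)) (at y)"
    and G: "(G has_derivative L) (at x)" and e: "e > 0"
  obtains d where "d > 0" "\<And>t. 0 < t \<Longrightarrow> t < d \<Longrightarrow>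
    \<bar>F (x + t *\<^sub>R u + t *\<^sub>R v) - F (x + t *\<^sub>R u) - F (x + t *\<^sub>R v) + F x - t\<^sup>2 * (L v \<bullet> u)\<bar>
      \<le> e * t\<^sup>2 * ((2 * norm u + norm v) * norm u)"
proof -
  from G have lin: "linear L" by (rule has_derivative_linear)
  from G e obtain r where r: "r > 0"
    and Gr: "\<And>y. norm (y - x) < r \<Longrightarrow> norm (G y - G x - L (y - x)) \<le> e * norm (y - x)"
    unfolding has_derivative_at_alt by blast
  \<comment> \<open>Keeps both points \<open>x + s *\<^sub>R u\<close> and
    \<open>x + s *\<^sub>R u + t *\<^sub>R v\<close>, with \<open>0 < s < t\<close>, within
    \<open>r\<close> of \<open>x\<close>; the summand 1 prevents a division by zero.\<close>
  define d where "d = r / (norm u + norm v + 1)"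
  have pos: "norm u + norm v + 1 > 0" by (simp add: add_nonneg_pos)
  have d: "d > 0" unfolding d_def using r pos by simp
  moreover have "\<bar>F (x + t *\<^sub>R u + t *\<^sub>R v) - F (x + t *\<^sub>R u) - F (x + t *\<^sub>R v) + F x - t\<^sup>2 * (L v \<bullet> u)\<bar>
      \<le> e * t\<^sup>2 * ((2 * norm u + norm v) * norm u)" if t: "0 < t" "t < d" for t
  proof -
    define g where "g s = F (x + s *\<^sub>R u + t *\<^sub>R v) - F (x + s *\<^sub>R u)" for s
    have "(g has_real_derivative (G (x + s *\<^sub>R u + t *\<^sub>R v) - G (x + s *\<^sub>R u)) \<bullet> u) (at s)" for s
    proof -
      have 1: "((\<lambda>s. F (x + s *\<^sub>R u + t *\<^sub>R v)) has_derivative (\<lambda>h. G (x + s *\<^sub>R u + t *\<^sub>R v) \<bullet> (h *\<^sub>R u))) (at s)"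
        by (rule has_derivative_compose[of "\<lambda>s. x + s *\<^sub>R u + t *\<^sub>R v", OF _ F])
          (auto intro!: derivative_eq_intros)
      have 2: "((\<lambda>s. F (x + s *\<^sub>R u)) has_derivative (\<lambda>h. G (x + s *\<^sub>R u) \<bullet> (h *\<^sub>R u))) (at s)"
        by (rule has_derivative_compose[of "\<lambda>s. x + s *\<^sub>R u", OF _ F])
          (auto intro!: derivative_eq_intros)
      show ?thesis
        unfolding has_field_derivative_def g_def
        by (rule has_derivative_eq_rhs[OF has_derivative_diff[OF 1 2]])
          (auto simp: inner_diff_left algebra_simps)
    qed
    from MVT2[OF t(1) this] obtain s where s: "0 < s" "s < t"
      and gs: "g t - g 0 = t * ((G (x + s *\<^sub>R u + t *\<^sub>R v) - G (x + s *\<^sub>R u)) \<bullet> u)"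
      by auto
    have tr: "t * (norm u + norm v + 1) < r" using t(2) pos unfolding d_def by (simp add: field_simps)
    have su: "norm (s *\<^sub>R u) \<le> t * norm u" using s by (simp add: mult_right_mono)
    have suv: "norm (s *\<^sub>R u + t *\<^sub>R v) \<le> t * norm u + t * norm v"
      using norm_triangle_ineq[of "s *\<^sub>R u" "t *\<^sub>R v"] su s by simp
    have "t * norm u \<ge> 0" "t * norm v \<ge> 0" using t by auto
    moreover have "t * norm u + t * norm v < r" using tr t by (simp add: algebra_simps)
    ultimately have sr: "norm (s *\<^sub>R u) < r" "norm (s *\<^sub>R u + t *\<^sub>R v) < r"
      using su suv by linarith+
    define a where "a = G (x + (s *\<^sub>R u + t *\<^sub>R v)) - G x - L (s *\<^sub>R u + t *\<^sub>R v)"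
    define b where "b = G (x + s *\<^sub>R u) - G x - L (s *\<^sub>R u)"
    have "norm a \<le> e * norm (s *\<^sub>R u + t *\<^sub>R v)"
      using Gr[of "x + (s *\<^sub>R u + t *\<^sub>R v)"] sr(2) unfolding a_def by simp
    also have "\<dots> \<le> e * (t * norm u + t * norm v)" using suv e by (simp add: mult_left_mono)
    finally have a: "norm a \<le> e * (t * norm u + t * norm v)" .
    have "norm b \<le> e * norm (s *\<^sub>R u)"
      using Gr[of "x + s *\<^sub>R u"] sr(1) unfolding b_def by simp
    also have "\<dots> \<le> e * (t * norm u)" using su e by (intro mult_left_mono) auto
    finally have b: "norm b \<le> e * (t * norm u)" .
    have Geq: "G (x + s *\<^sub>R u + t *\<^sub>R v) - G (x + s *\<^sub>R u) = a - b + t *\<^sub>R L v"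
      unfolding a_def b_def using lin by (simp add: linear_add linear_cmul add.assoc)
    have "g t - g 0 - t\<^sup>2 * (L v \<bullet> u) = t * ((a - b) \<bullet> u)"
      using gs unfolding Geq by (simp add: algebra_simps inner_add_left power2_eq_square)
    moreover have "\<bar>(a - b) \<bullet> u\<bar> \<le> (norm a + norm b) * norm u"
      by (meson Cauchy_Schwarz_ineq2 mult_right_mono norm_ge_zero norm_triangle_ineq4 order_trans)
    then have "\<bar>(a - b) \<bullet> u\<bar> \<le> (e * (t * norm u + t * norm v) + e * (t * norm u)) * norm u"
      using a b by (meson add_mono mult_right_mono norm_ge_zero order_trans)
    then have "t * \<bar>(a - b) \<bullet> u\<bar> \<le> t * ((e * (t * norm u + t * norm v) + e * (t * norm u)) * norm u)"
      using t by (intro mult_left_mono) auto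
    ultimately have "\<bar>g t - g 0 - t\<^sup>2 * (L v \<bullet> u)\<bar> \<le> t * ((e * (t * norm u + t * norm v) + e * (t * norm u)) * norm u)"
      using t by (simp add: abs_mult)
    also have "\<dots> = e * t\<^sup>2 * ((2 * norm u + norm v) * norm u)"
      by (simp add: algebra_simps power2_eq_square)
    finally show ?thesis by (simp add: g_def algebra_simps)
  qed
  ultimately show thesis using that by blast
qed

lemma second_derivative_symmetric:
  fixes F :: "real^'n \<Rightarrow> real" and G :: "real^'n \<Rightarrow> real^'n"
  assumes F: "\<And>y. (F has_derivative (\<lambda>h. G y \<bullet> h)) (at y)"
    and G: "(G has_derivative L) (at x)"
  shows "L v \<bullet> u = L u \<bullet> v"
proof -
  define K where "K = (2 * norm u + norm v) * norm u + (2 * norm v + norm u) * norm v"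
  have "\<bar>L v \<bullet> u - L u \<bullet> v\<bar> \<le> 0 + e" if e0: "e > 0" for e
  proof -
    define e' where "e' = e / (K + 1)"
    have K: "K \<ge> 0" unfolding K_def by simp
    then have e: "e' > 0" using e0 unfolding e'_def by simp
    obtain d1 where d1: "d1 > 0" and b1: "\<And>t. 0 < t \<Longrightarrow> t < d1 \<Longrightarrow>
      \<bar>F (x + t *\<^sub>R u + t *\<^sub>R v) - F (x + t *\<^sub>R u) - F (x + t *\<^sub>R v) + F x - t\<^sup>2 * (L v \<bullet> u)\<bar>
        \<le> e' * t\<^sup>2 * ((2 * norm u + norm v) * norm u)"
      using second_difference_bound[OF F G e] by blast
    obtain d2 where d2: "d2 > 0" and b2: "\<And>t. 0 < t \<Longrightarrow> t < d2 \<Longrightarrow>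
      \<bar>F (x + t *\<^sub>R v + t *\<^sub>R u) - F (x + t *\<^sub>R v) - F (x + t *\<^sub>R u) + F x - t\<^sup>2 * (L u \<bullet> v)\<bar>
        \<le> e' * t\<^sup>2 * ((2 * norm v + norm u) * norm v)"
      using second_difference_bound[OF F G e] by blast
    define t where "t = min d1 d2 / 2"
    have t: "0 < t" "t < d1" "t < d2" using d1 d2 by (auto simp: t_def)
    have "x + t *\<^sub>R v + t *\<^sub>R u = x + t *\<^sub>R u + t *\<^sub>R v" by simp
    then have "\<bar>t\<^sup>2 * (L v \<bullet> u) - t\<^sup>2 * (L u \<bullet> v)\<bar>
        \<le> e' * t\<^sup>2 * ((2 * norm u + norm v) * norm u) + e' * t\<^sup>2 * ((2 * norm v + norm u) * norm v)"
      using b1[OF t(1,2)] b2[OF t(1,3)] unfolding abs_le_iff by (simp only:) linarith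
    also have "\<dots> = t\<^sup>2 * (e' * K)" by (simp add: K_def algebra_simps)
    finally have "t\<^sup>2 * \<bar>L v \<bullet> u - L u \<bullet> v\<bar> \<le> t\<^sup>2 * (e' * K)"
      by (simp add: abs_mult flip: right_diff_distrib)
    then have "\<bar>L v \<bullet> u - L u \<bullet> v\<bar> \<le> e' * K" using t by simp
    also have "\<dots> \<le> e' * (K + 1)" using e by simp
    also have "\<dots> = e" using K by (simp add: e'_def)
    finally show ?thesis by simp
  qed
  then have "\<bar>L v \<bullet> u - L u \<bullet> v\<bar> \<le> 0" by (rule field_le_epsilon)
  then show ?thesis by simp
qed

lemma hess_symmetric:
  assumes "twice_diff F"
  shows "(hess F x *v u) \<bullet> v = (hess F x *v v) \<bullet> u"
  using assms unfolding twice_diff_def hess_def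
  by (intro second_derivative_symmetric[of F "grad F" _ x] grad_has_derivative Jac_has_derivative) auto

section \<open>A criterion for Poisson tensors in terms of the derivative of the tensor\<close>

lemma bounded_bilinear_matrix_vector_mult:
  "bounded_bilinear (\<lambda>(A::real^'n^'m) x. A *v x)"
  by (rule bilinear_conv_bounded_bilinear[THEN iffD1])
    (auto simp: bilinear_def algebra_simps scaleR_matrix_vector_assoc intro!: linearI)

lemmas has_derivative_matrix_vector_mult =
  bounded_bilinear.FDERIV[OF bounded_bilinear_matrix_vector_mult]

text \<open>In the cyclic sum of the Jacobi identity the second derivatives of the three functions
  cancel in pairs by symmetry of the Hessians. What remains involves the gradients only as vectors
  at \<open>x\<close>, hence the condition on arbitrary \<open>a\<close>, \<open>b\<close>,
  \<open>c\<close>.\<close>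

lemma poisson_tensorI:
  fixes P :: "real^'n \<Rightarrow> real^'n^'n"
  assumes skew: "\<And>x. transpose (P x) = - P x"
    and der: "\<And>x. (P has_derivative P' x) (at x)"
    and jacobi: "\<And>x a b c. b \<bullet> (P' x (P x *v a) *v c) + c \<bullet> (P' x (P x *v b) *v a)
                   + a \<bullet> (P' x (P x *v c) *v b) = 0"
  shows "poisson_tensor P"
proof -
  have sk: "a \<bullet> (P x *v b) = - ((P x *v a) \<bullet> b)" for x a b
  proof -
    have "a \<bullet> (P x *v b) = (transpose (P x) *v a) \<bullet> b"
      by (simp add: dot_lmul_matrix)
    also have "\<dots> = - ((P x *v a) \<bullet> b)" unfolding skew by (simp add: matrix_vector_minus del: transpose_matrix_vector)
    finally show ?thesis .
  qed
  \<comment> \<open>By skewness, bracketing with \<open>F\<close> on the left is minus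
    differentiation along \<open>P x *v grad F x\<close>; the inner bracket is differentiated by the
    product rule.\<close>
  have D: "pbr P F (pbr P G K) x =
      - ((hess G x *v (P x *v grad F x)) \<bullet> (P x *v grad K x)
         + grad G x \<bullet> (P' x (P x *v grad F x) *v grad K x)
         - (P x *v grad G x) \<bullet> (hess K x *v (P x *v grad F x)))"
    if "twice_diff G" "twice_diff K" for F G K x
  proof -
    have g: "(grad G has_derivative (\<lambda>h. hess G x *v h)) (at x)"
      and k: "(grad K has_derivative (\<lambda>h. hess K x *v h)) (at x)"
      using that unfolding twice_diff_def hess_def by (auto intro: Jac_has_derivative)
    have d: "(pbr P G K has_derivative (\<lambda>h. (hess G x *v h) \<bullet> (P x *v grad K x)
         + grad G x \<bullet> (P' x h *v grad K x)
         - (P x *v grad G x) \<bullet> (hess K x *v h))) (at x)"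
      unfolding pbr_def
      by (rule has_derivative_eq_rhs[OF has_derivative_inner[OF g has_derivative_matrix_vector_mult[OF der k]]])
        (auto simp: inner_add_right sk)
    then have "pbr P G K differentiable at x" unfolding differentiable_def by blast
    from grad_has_derivative[OF this] d
    have "grad (pbr P G K) x \<bullet> h = (hess G x *v h) \<bullet> (P x *v grad K x)
         + grad G x \<bullet> (P' x h *v grad K x)
         - (P x *v grad G x) \<bullet> (hess K x *v h)" for h
      by (metis (no_types, lifting) has_derivative_unique)
    moreover have "pbr P F (pbr P G K) x = - (grad (pbr P G K) x \<bullet> (P x *v grad F x))"
      by (metis (no_types) pbr_def sk inner_commute)
    ultimately show ?thesis by simp
  qed
  show ?thesis unfolding poisson_tensor_def
  proof (intro conjI allI impI)
    fix F G :: "real^'n \<Rightarrow> real"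
    show "pbr P F G = (\<lambda>x. - pbr P G F x)"
      unfolding pbr_def using sk by (metis inner_commute)
  next
    fix F G K :: "real^'n \<Rightarrow> real" and x
    assume t: "twice_diff F" "twice_diff G" "twice_diff K"
    show "pbr P F (pbr P G K) x + pbr P G (pbr P K F) x + pbr P K (pbr P F G) x = 0"
      unfolding D[OF t(2,3)] D[OF t(3,1)] D[OF t(1,2)]
      using jacobi[of "grad G x" x "grad F x" "grad K x"]
        hess_symmetric[OF t(1), of x "P x *v grad K x" "P x *v grad G x"]
        hess_symmetric[OF t(2), of x "P x *v grad F x" "P x *v grad K x"]
        hess_symmetric[OF t(3), of x "P x *v grad G x" "P x *v grad F x"]
      by (simp add: inner_commute)
  qed
qed

section \<open>Kahan maps and cubic forms\<close>

lemma differentiable_det: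
  fixes X :: "'a::real_normed_vector \<Rightarrow> real^'n^'n"
  assumes "\<And>i j. (\<lambda>y. X y $ i $ j) differentiable at x"
  shows "(\<lambda>y. det (X y)) differentiable at x"
proof -
  have prod: "(\<lambda>y. \<Prod>i\<in>S. X y $ i $ p i) differentiable at x" if "finite S" for p S
    using that by induction (auto intro!: differentiable_mult assms)
  show ?thesis unfolding det_def
    by (intro differentiable_sum differentiable_mult differentiable_const prod ballI)
      (auto simp: finite_permutations)
qed

lemma differentiable_vec_lambda:
  fixes X :: "'a::real_normed_vector \<Rightarrow> 'n::finite \<Rightarrow> real"
  assumes "\<And>i. (\<lambda>y. X y i) differentiable at x"
  shows "(\<lambda>y. \<chi> i. X y i) differentiable at x"
  by (rule differentiable_componentwise_within[THEN iffD2])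
    (use assms in \<open>auto simp: Basis_vec_def inner_axis\<close>)

lemma matrix_inv_right:
  assumes "invertible A"
  shows "A ** matrix_inv A = mat 1"
  using assms unfolding invertible_def matrix_inv_def by (rule someI2_ex) blast

lemma has_derivative_vec_nth: "((\<lambda>x::real^'n. x $ i) has_derivative (\<lambda>h. h $ i)) (at x)"
  by (rule bounded_linear_imp_has_derivative) (rule bounded_linear_vec_nth)

text \<open>Differentiating the implicit equation \<open>(mat 1 - \<epsilon> *\<^sub>R N y) *v kahan
  \<epsilon> h y = y\<close> in direction \<open>v\<close> produces the term
  \<open>N v *v kahan \<epsilon> h x\<close>, and \<open>sym\<close> exchanges its two arguments.
  Differentiability of the Kahan map at \<open>x\<close> has to be shown first.\<close>

lemma Jac_kahan:
  fixes N :: "real^'n \<Rightarrow> real^'n^'n"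
  assumes lin: "linear N" and sym: "\<And>x y. N x *v y = N y *v x"
    and Jac: "\<And>x. Jac h x = N x" and inv: "invertible (mat 1 - \<epsilon> *\<^sub>R N x)"
  shows "(mat 1 - \<epsilon> *\<^sub>R N x) ** Jac (kahan \<epsilon> h) x = mat 1 + \<epsilon> *\<^sub>R N (kahan \<epsilon> h x)"
proof -
  define L where "L y = mat 1 - \<epsilon> *\<^sub>R N y" for y
  have Nder: "(N has_derivative N) (at y)" for y
    using lin by (simp add: linear_imp_has_derivative)
  then have Nd: "(\<lambda>y. N y $ i $ j) differentiable at y" for i j y
    using bounded_linear.has_derivative[OF bounded_linear_vec_nth bounded_linear.has_derivative[OF bounded_linear_vec_nth Nder]]
    unfolding differentiable_def by blast
  have Ld: "(\<lambda>y. L y $ i $ j) differentiable at y" for i j y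
    unfolding L_def using Nd[of i j] by simp
  have detL: "(\<lambda>y. det (L y)) differentiable at x" by (rule differentiable_det) (rule Ld)
  have nz: "det (L x) \<noteq> 0" using inv invertible_det_nz unfolding L_def by blast
  have "isCont (\<lambda>y. det (L y)) x" using detL by (rule differentiable_imp_continuous_within)
  then have ev: "eventually (\<lambda>y. det (L y) \<noteq> 0) (at x)"
    using nz by (simp add: isCont_def tendsto_imp_eventually_ne)
  have fix_eq: "L y *v kahan \<epsilon> h y = y" if "det (L y) \<noteq> 0" for y
  proof -
    have "invertible (L y)" using that invertible_det_nz by blast
    then have "L y ** matrix_inv (L y) = mat 1" by (rule matrix_inv_right)
    then show ?thesis unfolding kahan_def Jac L_def[symmetric] by (simp add: matrix_vector_mul_assoc)
  qed
  \<comment> \<open>Cramer's rule: the components are quotients of determinants, hence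
    differentiable at \<open>x\<close>. The Kahan map agrees with \<open>\<Psi>\<close> wherever
    \<open>det (L y)\<close> is nonzero, thus near \<open>x\<close>, and inherits the
    derivative.\<close>
  define \<Psi> where "\<Psi> y = (\<chi> k. det (\<chi> i j. if j = k then y$i else L y$i$j) / det (L y))" for y
  have eq: "\<Psi> y = kahan \<epsilon> h y" if "det (L y) \<noteq> 0" for y
    unfolding \<Psi>_def by (rule cramer[OF that, THEN iffD1, OF fix_eq[OF that], symmetric])
  have vd: "(\<lambda>y::real^'n. y $ i) differentiable at x" for i
    using has_derivative_vec_nth unfolding differentiable_def by blast
  have "\<Psi> differentiable at x" unfolding \<Psi>_def
  proof (intro differentiable_vec_lambda differentiable_divide detL nz differentiable_det)
    fix k i j
    show "(\<lambda>y. (\<chi> i j. if j = k then y $ i else L y $ i $ j) $ i $ j) differentiable at x"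
      using vd Ld by (cases "j = k") simp_all
  qed
  then obtain D where "(\<Psi> has_derivative D) (at x)" unfolding differentiable_def by blast
  then have D: "(kahan \<epsilon> h has_derivative D) (at x)"
    by (rule has_derivative_transform_eventually) (use ev eq nz in \<open>auto elim: eventually_mono\<close>)
  then have DJ: "(kahan \<epsilon> h has_derivative (\<lambda>v. Jac (kahan \<epsilon> h) x *v v)) (at x)"
    by (intro Jac_has_derivative) (auto simp: differentiable_def)
  have "((\<lambda>y. L y) has_derivative (\<lambda>v. - \<epsilon> *\<^sub>R N v)) (at x)"
    unfolding L_def using Nder[of x] by (auto intro!: derivative_eq_intros)
  from has_derivative_matrix_vector_mult[OF this DJ]
  have "((\<lambda>y. L y *v kahan \<epsilon> h y) has_derivative
      (\<lambda>v. L x *v (Jac (kahan \<epsilon> h) x *v v) + (- \<epsilon> *\<^sub>R N v) *v kahan \<epsilon> h x)) (at x)" .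
  moreover have "((\<lambda>y. L y *v kahan \<epsilon> h y) has_derivative (\<lambda>v. v)) (at x)"
    by (rule has_derivative_transform_eventually[OF has_derivative_ident])
      (use ev fix_eq nz in \<open>auto elim: eventually_mono\<close>)
  ultimately have "L x *v (Jac (kahan \<epsilon> h) x *v v) + (- \<epsilon> *\<^sub>R N v) *v kahan \<epsilon> h x = v" for v
    by (metis (no_types, lifting) has_derivative_unique)
  then have "L x *v (Jac (kahan \<epsilon> h) x *v v) = v + \<epsilon> *\<^sub>R (N v *v kahan \<epsilon> h x)" for v
    unfolding scaleR_matrix_vector_assoc[symmetric] by (simp add: diff_eq_eq)
  then have "(L x ** Jac (kahan \<epsilon> h) x) *v v = (mat 1 + \<epsilon> *\<^sub>R N (kahan \<epsilon> h x)) *v v" for v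
    using sym[of v "kahan \<epsilon> h x"]
    by (simp add: matrix_vector_mul_assoc[symmetric] matrix_vector_mult_add_rdistrib scaleR_matrix_vector_assoc[symmetric])
  then show ?thesis unfolding L_def matrix_eq by blast
qed

text \<open>The Hessian of a cubic form is its symmetrized trilinear form with one slot filled by
  \<open>x\<close>. Symmetry in the other two slots makes \<open>S x\<close> a symmetric matrix;
  symmetry involving the filled slot gives \<open>S x *v y = S y *v x\<close>.\<close>

lemma cubic_form_hess:
  assumes "cubic_form H"
  obtains S where "linear S" "\<And>x. transpose (S x) = S x" "\<And>x y. S x *v y = S y *v x"
    "\<And>x. (grad H has_derivative (\<lambda>h. S x *v h)) (at x)"
proof -
  obtain c :: "6 \<Rightarrow> 6 \<Rightarrow> 6 \<Rightarrow> real" where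
    c: "\<And>x. H x = (\<Sum>i\<in>UNIV. \<Sum>j\<in>UNIV. \<Sum>k\<in>UNIV. c i j k * x$i * x$j * x$k)"
    using assms unfolding cubic_form_def by blast
  define t where "t c x y z = (\<Sum>i\<in>UNIV. \<Sum>j\<in>UNIV. \<Sum>k\<in>UNIV. c i j k * x$i * y$j * z$k)"
    for c :: "6 \<Rightarrow> 6 \<Rightarrow> 6 \<Rightarrow> real" and x y z :: "real^6"
  have t12: "t (\<lambda>i j k. c j i k) x y z = t c y x z" for c x y z
    unfolding t_def by (subst sum.swap) (simp add: mult_ac)
  have t23: "t (\<lambda>i j k. c i k j) x y z = t c x z y" for c x y z
    unfolding t_def by (rule sum.cong[OF refl]) (subst sum.swap, simp add: mult_ac)
  have tadd: "t (\<lambda>i j k. c i j k + d i j k) x y z = t c x y z + t d x y z" for c d x y z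
    by (simp add: t_def algebra_simps sum.distrib)
  \<comment> \<open>The sum over all six permutations carries no factor 1/6, so that
    \<open>S\<close> is exactly the Hessian and the gradient is half of
    \<open>S x *v x\<close>.\<close>
  define s where "s i j k = c i j k + c i k j + c j i k + c j k i + c k i j + c k j i" for i j k
  have ssym: "s j i k = s i j k" "s i k j = s i j k" for i j k by (simp_all add: s_def)
  have ts: "t s h x x = 2 * (t c h x x + t c x h x + t c x x h)" for h x
  proof -
    have e3: "t (\<lambda>i j k. c j k i) h x x = t c x x h"
      using t12[of "\<lambda>i j k. c i k j" h x x] unfolding t23[of c] .
    have e4: "t (\<lambda>i j k. c k i j) h x x = t c x h x"
      using t23[of "\<lambda>i j k. c j i k" h x x] unfolding t12[of c] .
    have e5: "t (\<lambda>i j k. c k j i) h x x = t c x x h"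
      using t23[of "\<lambda>i j k. c j k i" h x x] unfolding e3 .
    have "t s h x x = t c h x x + t c h x x + t c x h x + t c x x h + t c x h x + t c x x h"
      unfolding s_def[abs_def] tadd t23[of c] t12[of c] e3 e4 e5 ..
    then show ?thesis by simp
  qed
  define S where "S x = (\<chi> i j. \<Sum>k\<in>UNIV. s i j k * x$k)" for x :: "real^6"
  have Sv: "(S x *v y) \<bullet> h = t s h y x" for x y h
    unfolding S_def t_def inner_vec_def matrix_vector_mult_def
    by (simp add: sum_distrib_left sum_distrib_right mult_ac)
  have linS: "linear S"
    by (rule linearI) (simp_all add: S_def vec_eq_iff algebra_simps sum.distrib sum_distrib_left)
  have symS: "transpose (S x) = S x" for x
    by (simp add: vec_eq_iff S_def transpose_def) (intro allI sum.cong refl arg_cong2[where f=times] ssym(1))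
  have sw: "S x *v y = S y *v x" for x y
  proof -
    have "(\<lambda>i j k. s i k j) = s" by (intro ext) (rule ssym(2))
    then have "(S x *v y) \<bullet> h = (S y *v x) \<bullet> h" for h
      unfolding Sv using t23[of s h x y] by simp
    then show ?thesis by (metis vector_eq_rdot)
  qed
  have tder: "((\<lambda>x. t c x x x) has_derivative (\<lambda>h. t c h x x + t c x h x + t c x x h)) (at x)" for x
    unfolding t_def sum.distrib[symmetric]
    by (intro has_derivative_sum has_derivative_eq_rhs[OF has_derivative_mult[OF has_derivative_mult[OF
          has_derivative_mult_right[OF has_derivative_vec_nth] has_derivative_vec_nth] has_derivative_vec_nth]])
      (simp add: fun_eq_iff algebra_simps)
  have "H = (\<lambda>x. t c x x x)" using c unfolding t_def by blast
  then have "(H has_derivative (\<lambda>h. ((1/2) *\<^sub>R (S x *v x)) \<bullet> h)) (at x)" for x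
    using tder[of x] by (simp add: Sv ts add_divide_distrib)
  then have grad: "grad H = (\<lambda>x. (1/2) *\<^sub>R (S x *v x))" using grad_eqI by blast
  have "(S has_derivative S) (at x)" for x
    using linS by (simp add: linear_imp_has_derivative)
  from has_derivative_matrix_vector_mult[OF this has_derivative_ident]
  have "((\<lambda>x. S x *v x) has_derivative (\<lambda>h. S x *v h + S h *v x)) (at x)" for x .
  then have "(grad H has_derivative (\<lambda>h. (1/2) *\<^sub>R (S x *v h + S h *v x))) (at x)" for x
    unfolding grad by (rule has_derivative_scaleR_right)
  moreover have "(1/2) *\<^sub>R (S x *v h + S h *v x) = S x *v h" for x h
    unfolding sw[of h x] by (simp flip: scaleR_2)
  ultimately have "(grad H has_derivative (\<lambda>h. S x *v h)) (at x)" for x by simp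
  then show thesis using that linS symS sw by blast
qed

section \<open>Spectral splitting\<close>

lemma matrix_commute_mult:
  fixes X Y Z :: "'a::semiring_1^'n^'n"
  assumes "X ** Z = Z ** X" "Y ** Z = Z ** Y"
  shows "(X ** Y) ** Z = Z ** (X ** Y)"
proof -
  have "(X ** Y) ** Z = X ** (Y ** Z)" by (simp only: matrix_mul_assoc)
  also have "\<dots> = (X ** Z) ** Y" by (simp only: assms(2) matrix_mul_assoc)
  also have "\<dots> = Z ** (X ** Y)" by (simp only: assms(1) matrix_mul_assoc)
  finally show ?thesis .
qed

text \<open>\<open>C\<close> stands for the complexified transpose of \<open>A\<close>. Each
  \<open>P i\<close> is the Lagrange interpolation polynomial for \<open>lam i\<close> evaluated at
  \<open>C\<close>, that is, the prospective spectral projection; \<open>interp\<close> forces the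
  three eigenvalues to be distinct.\<close>

locale spectral_splitting =
  fixes J C :: "complex^6^6" and lam a b c :: "nat \<Rightarrow> complex" and P :: "nat \<Rightarrow> complex^6^6"
  assumes J_skew: "transpose J = - J" and J_sq: "J ** J = - mat 1"
    and CJ_skew: "transpose (C ** J) = - (C ** J)"
    and eig: "i \<in> {1,2,3} \<Longrightarrow> det (mat (lam i) - C) = 0"
    and interp: "i \<in> {1,2,3} \<Longrightarrow> j \<in> {1,2,3} \<Longrightarrow>
      a i + b i * lam j + c i * (lam j)\<^sup>2 = (if i = j then 1 else 0)"
    and P_def: "P i = a i *k mat 1 + b i *k C + c i *k (C ** C)"
begin

text \<open>\<open>(mat (lam i) - C) ** J\<close> is skew and singular, so its kernel contains two
  independent vectors. Multiplication by \<open>J\<close> maps them to eigenvectors of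
  \<open>C\<close> and preserves independence because \<open>J\<close> is invertible.\<close>

lemma eigenplane:
  assumes i: "i \<in> {1,2,3}"
  shows "\<exists>u w. C *v u = lam i *s u \<and> C *v w = lam i *s w \<and>
    (\<forall>s t. s *s u + t *s w = 0 \<longrightarrow> s = 0 \<and> t = 0)"
proof -
  let ?K = "(mat (lam i) - C) ** J"
  have "transpose ?K = - ?K"
    using CJ_skew by (simp add: matrix_diff_rdistrib mat_mul_left transpose_simps transpose_scalar_mult J_skew scalar_matrix_simps)
  moreover have "det ?K = 0" using eig[OF i] by (simp add: det_mul)
  ultimately obtain u w where u: "?K *v u = 0" and w: "?K *v w = 0"
    and ind: "\<And>a b. a *s u + b *s w = 0 \<Longrightarrow> a = 0 \<and> b = 0"
    using skew_even_kernel[of ?K] by auto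
  have ev: "C *v (J *v z) = lam i *s (J *v z)" if "?K *v z = 0" for z
  proof -
    have "mat (lam i) *v (J *v z) - C *v (J *v z) = 0"
      using that by (simp add: matrix_vector_mul_assoc matrix_diff_rdistrib matrix_vector_mult_diff_rdistrib)
    moreover have "mat (lam i) *v (J *v z) = lam i *s (J *v z)"
      by (subst mat_eq_scalar) (simp add: scalar_matrix_vector)
    ultimately show ?thesis by simp
  qed
  have JJ: "J *v (J *v z) = - z" for z
    by (simp add: matrix_vector_mul_assoc J_sq matrix_vector_minus)
  have "s = 0 \<and> t = 0" if "s *s (J *v u) + t *s (J *v w) = 0" for s t
  proof -
    have "J *v (s *s (J *v u) + t *s (J *v w)) = 0" using that by simp
    then have "- (s *s u + t *s w) = 0"
      by (simp add: matrix_vector_right_distrib vector_scalar_commute JJ)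
    then show ?thesis using ind by (metis neg_equal_0_iff_equal)
  qed
  then show ?thesis using ev[OF u] ev[OF w] by blast
qed

lemma P_eigenvector:
  assumes "i \<in> {1,2,3}" "j \<in> {1,2,3}" "C *v v = lam j *s v"
  shows "P i *v v = (if i = j then v else 0)"
proof -
  have "P i *v v = (a i + b i * lam j + c i * (lam j)\<^sup>2) *s v"
    unfolding P_def
    by (simp add: matrix_vector_mult_add_rdistrib scalar_matrix_vector assms(3) vector_scalar_commute
        matrix_vector_mul_assoc[symmetric])
      (simp add: vec_eq_iff algebra_simps power2_eq_square)
  then show ?thesis using interp[OF assms(1,2)] by auto
qed

text \<open>Two eigenvectors for each of the three eigenvalues form a basis: \<open>P i\<close>
  isolates the part belonging to \<open>lam i\<close> in any linear relation, and within an
  eigenplane the two vectors are independent. Thus \<open>C\<close> is diagonalizable although its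
  eigenvalues are double.\<close>

lemma eigenbasis:
  obtains u w where "\<forall>i\<in>{1,2,3}. C *v u i = lam i *s u i"
    "\<forall>i\<in>{1,2,3}. C *v w i = lam i *s w i"
    "\<forall>z. \<exists>\<alpha> \<beta>. z = (\<Sum>i\<in>{1,2,3}. \<alpha> i *s u i + \<beta> i *s w i) \<and>
       (\<forall>i\<in>{1,2,3}. P i *v z = \<alpha> i *s u i + \<beta> i *s w i)"
proof -
  have "\<exists>u. \<forall>i\<in>{1,2,3}. \<exists>w. C *v u i = lam i *s u i \<and> C *v w = lam i *s w \<and>
    (\<forall>s t. s *s u i + t *s w = 0 \<longrightarrow> s = 0 \<and> t = 0)"
    by (rule bchoice) (blast intro: eigenplane)
  then obtain u where "\<forall>i\<in>{1,2,3}. \<exists>w. C *v u i = lam i *s u i \<and> C *v w = lam i *s w \<and>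
    (\<forall>s t. s *s u i + t *s w = 0 \<longrightarrow> s = 0 \<and> t = 0)" by blast
  from bchoice[OF this] obtain w where uw: "\<forall>i\<in>{1,2,3}. C *v u i = lam i *s u i \<and> C *v w i = lam i *s w i \<and>
    (\<forall>s t. s *s u i + t *s w i = 0 \<longrightarrow> s = 0 \<and> t = 0)" by blast
  have comp: "P i *v (\<Sum>j\<in>{1,2,3}. \<alpha> j *s u j + \<beta> j *s w j) = \<alpha> i *s u i + \<beta> i *s w i"
    if i: "i \<in> {1,2,3}" for \<alpha> \<beta> i
  proof -
    have "P i *v u j = (if i = j then u j else 0)" "P i *v w j = (if i = j then w j else 0)"
      if "j \<in> {1,2,3}" for j
      using P_eigenvector[OF i that] uw that by blast+
    from this[of 1] this[of 2] this[of 3] show ?thesis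
      using i by (auto simp: matrix_vector_right_distrib vector_scalar_commute)
  qed
  \<comment> \<open>The columns of \<open>T\<close> are the six eigenvectors in the order
    \<open>u 1\<close>, \<open>w 1\<close>, \<open>u 2\<close>, \<open>w 2\<close>,
    \<open>u 3\<close>, \<open>w 3\<close>; \<open>\<alpha>\<close> and \<open>\<beta>\<close> read
    the even and odd coordinates of a coefficient vector.\<close>
  define T :: "complex^6^6" where "T = (\<chi> r j. (if j = 0 then u 1 else if j = 1 then w 1 else if j = 2 then u 2
    else if j = 3 then w 2 else if j = 4 then u 3 else w 3) $ r)"
  define \<alpha> where "\<alpha> y i = (if i = 1 then y$0 else if i = 2 then y$2 else y$4)" for y :: "complex^6" and i :: nat
  define \<beta> where "\<beta> y i = (if i = 1 then y$1 else if i = 2 then y$3 else y$5)" for y :: "complex^6" and i :: nat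
  have T: "T *v y = (\<Sum>i\<in>{1,2,3}. \<alpha> y i *s u i + \<beta> y i *s w i)" for y
    by (simp add: vec_eq_iff matrix_vector_mult_def sum_6 T_def \<alpha>_def \<beta>_def mult.commute)
  have "y = 0" if y: "T *v y = 0" for y
  proof -
    have "\<alpha> y i = 0 \<and> \<beta> y i = 0" if i: "i \<in> {1,2,3}" for i
    proof -
      have "\<alpha> y i *s u i + \<beta> y i *s w i = 0"
        using comp[OF i, of "\<alpha> y" "\<beta> y"] y unfolding T by simp
      then show ?thesis using uw i by blast
    qed
    from this[of 1] this[of 2] this[of 3] show "y = 0"
      by (simp add: \<alpha>_def \<beta>_def vec_eq_iff forall_6)
  qed
  then obtain T' where "T' ** T = mat 1" using matrix_left_invertible_ker[of T] by blast
  then have TT: "T ** T' = mat 1" using matrix_left_right_inverse by blast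
  show thesis
  proof (rule that)
    show "\<forall>i\<in>{1,2,3}. C *v u i = lam i *s u i" "\<forall>i\<in>{1,2,3}. C *v w i = lam i *s w i"
      using uw by auto
    show "\<forall>z. \<exists>\<alpha> \<beta>. z = (\<Sum>i\<in>{1,2,3}. \<alpha> i *s u i + \<beta> i *s w i) \<and>
       (\<forall>i\<in>{1,2,3}. P i *v z = \<alpha> i *s u i + \<beta> i *s w i)"
    proof
      fix z
      have "z = T *v (T' *v z)" by (simp add: matrix_vector_mul_assoc TT)
      then have z: "z = (\<Sum>i\<in>{1,2,3}. \<alpha> (T' *v z) i *s u i + \<beta> (T' *v z) i *s w i)" unfolding T .
      have "\<forall>i\<in>{1,2,3}. P i *v z = \<alpha> (T' *v z) i *s u i + \<beta> (T' *v z) i *s w i"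
        using comp[of _ "\<alpha> (T' *v z)" "\<beta> (T' *v z)"] unfolding z[symmetric] by blast
      with z show "\<exists>\<alpha> \<beta>. z = (\<Sum>i\<in>{1,2,3}. \<alpha> i *s u i + \<beta> i *s w i) \<and>
         (\<forall>i\<in>{1,2,3}. P i *v z = \<alpha> i *s u i + \<beta> i *s w i)" by blast
    qed
  qed
qed

text \<open>Diagonalizability is used here: every vector expands in the eigenbasis and
  \<open>P i\<close> picks out its part in the eigenplane of \<open>lam i\<close>, where
  \<open>C\<close> acts as a scalar.\<close>

lemma sum_P: "(\<Sum>i\<in>{1,2,3}. P i) = mat 1"
  and C_P: "i \<in> {1,2,3} \<Longrightarrow> C ** P i = lam i *k P i"
proof -
  obtain u w where u: "\<forall>i\<in>{1,2,3}. C *v u i = lam i *s u i"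
    and w: "\<forall>i\<in>{1,2,3}. C *v w i = lam i *s w i"
    and z: "\<forall>z. \<exists>\<alpha> \<beta>. z = (\<Sum>i\<in>{1,2,3}. \<alpha> i *s u i + \<beta> i *s w i) \<and>
       (\<forall>i\<in>{1,2,3}. P i *v z = \<alpha> i *s u i + \<beta> i *s w i)" by (rule eigenbasis)
  show "(\<Sum>i\<in>{1,2,3}. P i) = mat 1"
    unfolding matrix_eq
  proof
    fix x
    obtain \<alpha> \<beta> where x: "x = (\<Sum>i\<in>{1,2,3}. \<alpha> i *s u i + \<beta> i *s w i)"
      and Px: "\<forall>i\<in>{1,2,3}. P i *v x = \<alpha> i *s u i + \<beta> i *s w i" using z by blast
    show "(\<Sum>i\<in>{1,2,3}. P i) *v x = mat 1 *v x"
      using Px by (subst (2) x) (simp add: matrix_vector_mult_add_rdistrib)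
  qed
  show "C ** P i = lam i *k P i" if i: "i \<in> {1,2,3}"
    unfolding matrix_eq
  proof
    fix x
    obtain \<alpha> \<beta> where "P i *v x = \<alpha> i *s u i + \<beta> i *s w i" using z i by blast
    then show "(C ** P i) *v x = (lam i *k P i) *v x"
      using bspec[OF u i] bspec[OF w i]
      by (simp add: scalar_matrix_vector matrix_vector_mul_assoc[symmetric] matrix_vector_right_distrib vector_scalar_commute)
        (simp add: vec_eq_iff algebra_simps)
  qed
qed

section \<open>Spectral projections and the rank-two skew matrices \<open>P i ** J\<close>\<close>

lemma P_mult_P:
  assumes "i \<in> {1,2,3}" "j \<in> {1,2,3}"
  shows "P i ** P j = (if i = j then P j else 0)"
proof -
  have "P i ** P j = a i *k P j + b i *k (C ** P j) + c i *k (C ** (C ** P j))"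
    unfolding P_def[of i] by (simp add: matrix_ring_simps)
  also have "\<dots> = (a i + b i * lam j + c i * (lam j)\<^sup>2) *k P j"
    by (simp add: C_P[OF assms(2)] matrix_scalar_right scalar_matrix_simps power2_eq_square algebra_simps)
  finally show ?thesis using interp[OF assms] by (simp add: scalar_matrix_simps)
qed

lemma P_comm:
  assumes "M ** C = C ** M"
  shows "M ** P i = P i ** M"
proof -
  have "M ** (C ** C) = (C ** C) ** M" using matrix_commute_mult[OF assms[symmetric] assms[symmetric]] by simp
  then show ?thesis unfolding P_def using assms
    by (simp add: matrix_add_ldistrib matrix_add_rdistrib matrix_scalar_left matrix_scalar_right)
qed

text \<open>Skewness of \<open>C ** J\<close> amounts to \<open>J ** transpose C = C ** J\<close>, a
  relation that passes to every polynomial in \<open>C\<close>.\<close>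

lemma PJ_skew: "transpose (P i ** J) = - (P i ** J)"
proof -
  have JC: "J ** transpose C = C ** J"
    using CJ_skew by (simp add: matrix_transpose_mul J_skew matrix_minus_left)
  have JCC: "J ** (transpose C ** transpose C) = C ** C ** J"
  proof -
    have "J ** (transpose C ** transpose C) = (J ** transpose C) ** transpose C" by (simp only: matrix_mul_assoc)
    also have "\<dots> = C ** (J ** transpose C)" by (simp only: JC[symmetric] matrix_mul_assoc)
    also have "\<dots> = C ** C ** J" by (simp only: JC) (simp only: matrix_mul_assoc)
    finally show ?thesis .
  qed
  have "J ** transpose (P i) = P i ** J"
    unfolding P_def transpose_simps transpose_scalar_mult matrix_transpose_mul
    by (simp add: matrix_add_ldistrib matrix_add_rdistrib matrix_scalar_left matrix_scalar_right JC JCC)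
  then show ?thesis by (simp add: matrix_transpose_mul J_skew matrix_minus_left)
qed

lemma PJ_skew_nth: "(P i ** J) $ r $ s = - (P i ** J) $ s $ r"
  using arg_cong[OF PJ_skew[of i], of "\<lambda>X. X $ s $ r"] by (simp add: transpose_def)

text \<open>All columns of \<open>P i ** J\<close> lie in the eigenplane spanned by
  \<open>u i\<close> and \<open>w i\<close>.\<close>

lemma PJ_rank_two:
  assumes i: "i \<in> {1,2,3}"
  obtains p q where "\<And>r s. (P i ** J) $ r $ s = p $ r * q $ s - q $ r * p $ s"
proof -
  obtain u w where "\<forall>i\<in>{1,2,3}. C *v u i = lam i *s u i"
    and "\<forall>i\<in>{1,2,3}. C *v w i = lam i *s w i"
    and z: "\<forall>z. \<exists>\<alpha> \<beta>. z = (\<Sum>i\<in>{1,2,3}. \<alpha> i *s u i + \<beta> i *s w i) \<and>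
       (\<forall>i\<in>{1,2,3}. P i *v z = \<alpha> i *s u i + \<beta> i *s w i)" by (rule eigenbasis)
  have col: "(P i ** J) $ r $ s = (P i *v column s J) $ r" for r s
    by (simp add: matrix_matrix_mult_def matrix_vector_mult_def column_def)
  have "\<exists>\<alpha> \<beta>. P i *v column s J = \<alpha> *s u i + \<beta> *s w i" for s
    using spec[OF z, of "column s J"] i by blast
  then obtain \<alpha> \<beta> where ab: "\<And>s. P i *v column s J = \<alpha> s *s u i + \<beta> s *s w i" by metis
  have cols: "(P i ** J) $ r $ s = u i $ r * (\<chi> s. \<alpha> s) $ s + w i $ r * (\<chi> s. \<beta> s) $ s" for r s
    unfolding col ab by (simp add: mult.commute)
  have diag: "(P i ** J) $ r $ r = 0" for r
    using PJ_skew_nth[of i r r] by simp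
  show thesis using skew_rank_two[OF PJ_skew_nth diag cols] that by blast
qed

lemma J_cancel: "X ** J = Y ** J \<Longrightarrow> X = Y"
proof -
  assume "X ** J = Y ** J"
  then have "X ** (J ** J) = Y ** (J ** J)" by (simp add: matrix_mul_assoc)
  then show "X = Y" by (simp add: J_sq matrix_minus_right)
qed

lemma P_anticommutator:
  assumes i: "i \<in> {1,2,3}" and S: "transpose S = S" and S': "transpose S' = S'"
    and comm: "(J ** S) ** C = C ** (J ** S)" and comm': "(J ** S') ** C = C ** (J ** S')"
    and Q: "Q = (J ** S) ** (J ** S') + (J ** S') ** (J ** S)"
  shows "P i ** Q = (trace (P i ** Q) / 2) *k P i"
proof -
  define W where "W = P i ** J"
  define R where "R = S ** W ** S' + S' ** W ** S"
  have "transpose R = - R"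
    unfolding R_def using PJ_skew[of i, folded W_def]
    by (simp add: transpose_simps matrix_transpose_mul S S' matrix_minus_left matrix_minus_right matrix_mul_assoc)
  then have Rsk: "R $ r $ s = - R $ s $ r" for r s
    by (metis (no_types) transpose_def vec_lambda_beta vector_uminus_component)
  obtain p q where W: "\<And>r s. W $ r $ s = p $ r * q $ s - q $ r * p $ s"
    using PJ_rank_two[OF i] unfolding W_def by blast
  have PP: "P i ** P i = P i" using P_mult_P[OF i i] by simp
  have PMPM: "P i ** X ** P i ** Y = P i ** (X ** Y)" if "X ** C = C ** X" for X Y
  proof -
    have "P i ** X ** P i ** Y = P i ** (X ** P i) ** Y" by (simp only: matrix_mul_assoc)
    also have "\<dots> = (P i ** P i) ** (X ** Y)" by (simp only: P_comm[OF that] matrix_mul_assoc)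
    finally show ?thesis unfolding PP .
  qed
  have WR: "W ** R = P i ** Q"
    unfolding R_def W_def Q using PMPM[OF comm, of "J ** S'"] PMPM[OF comm', of "J ** S"]
    by (simp add: matrix_add_ldistrib matrix_mul_assoc)
  have QC: "Q ** C = C ** Q" unfolding Q matrix_add_ldistrib matrix_add_rdistrib
    using matrix_commute_mult[OF comm comm'] matrix_commute_mult[OF comm' comm] by simp
  have "W ** R ** W = P i ** Q ** J"
    using PMPM[OF QC, of J] unfolding WR unfolding W_def by (simp only: matrix_mul_assoc)
  then have "P i ** Q ** J = ((trace (P i ** Q) / 2) *k P i) ** J"
    using rank_two_sandwich[OF W Rsk] unfolding WR by (simp add: W_def matrix_scalar_left)
  then show ?thesis by (rule J_cancel)
qed

end

section \<open>The splitting of a quadratic Hamiltonian field\<close>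

text \<open>Bilinear, without conjugation, so that real inner products extend to complex vectors by
  linearity in both arguments.\<close>

definition cdot :: "'a::comm_ring_1^'n \<Rightarrow> 'a^'n \<Rightarrow> 'a"
  where "cdot x y = (\<Sum>i\<in>UNIV. x $ i * y $ i)"

lemma cdot_simps:
  "cdot x (y + z) = cdot x y + cdot x z" "cdot x (y - z) = cdot x y - cdot x z"
  "cdot x (k *s y) = k * cdot x y" "cdot x (- y) = - cdot x y"
  by (simp_all add: cdot_def algebra_simps sum.distrib sum_subtractf sum_distrib_left sum_negf)

lemma cdot_commute: "cdot x y = cdot y x"
  by (simp add: cdot_def mult.commute)

text \<open>\<open>S\<close> and \<open>M\<close> are the complexified Hessian of the Hamiltonian
  and Jacobi matrix of the field. \<open>M_swap\<close> expresses that the second derivative of a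
  quadratic field is a symmetric bilinear map.\<close>

locale cubic_splitting = spectral_splitting +
  fixes S M :: "complex^6 \<Rightarrow> complex^6^6"
  assumes M_eq: "M z = J ** S z" and S_sym: "transpose (S z) = S z"
    and M_swap: "M z *v y = M y *v z" and M_C: "M z ** C = C ** M z"
begin

text \<open>\<open>M_swap\<close> moves the base point into the vector slot, where linearity is that
  of a matrix.\<close>

lemma M_add: "M (y + z) = M y + M z"
  unfolding matrix_eq by (metis M_swap matrix_vector_mult_add_rdistrib matrix_vector_right_distrib)

lemma M_scale: "M (k *s z) = k *k M z"
  unfolding matrix_eq by (metis M_swap scalar_matrix_vector vector_scalar_commute)

lemma M_P: "M (P i *v z) = P i ** M z"
  unfolding matrix_eq
proof
  fix y
  have "M (P i *v z) *v y = (M y ** P i) *v z" by (simp add: M_swap[of _ y] matrix_vector_mul_assoc)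
  also have "\<dots> = P i *v (M y *v z)" unfolding P_comm[OF M_C] by (simp add: matrix_vector_mul_assoc)
  also have "\<dots> = (P i ** M z) *v y" by (simp add: M_swap[of y] matrix_vector_mul_assoc)
  finally show "M (P i *v z) *v y = (P i ** M z) *v y" .
qed

text \<open>The derivative of \<open>M x ** M x\<close> in direction \<open>z\<close>.\<close>

definition anticomm :: "complex^6 \<Rightarrow> complex^6 \<Rightarrow> complex^6^6"
  where "anticomm x z = M z ** M x + M x ** M z"

definition weight :: "nat \<Rightarrow> complex^6 \<Rightarrow> complex^6 \<Rightarrow> complex"
  where "weight i x z = trace (P i ** anticomm x z) / 2"

lemma P_times_anticomm:
  "i \<in> {1,2,3} \<Longrightarrow> P i ** anticomm x z = weight i x z *k P i"
  unfolding weight_def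
  by (rule P_anticommutator[where S = "S z" and S' = "S x"])
    (auto simp: S_sym M_eq[symmetric] M_C anticomm_def)

lemma anticomm_eq: "anticomm x z = (\<Sum>i\<in>{1,2,3}. weight i x z *k P i)"
proof -
  have "anticomm x z = (\<Sum>i\<in>{1,2,3}. P i) ** anticomm x z" unfolding sum_P by simp
  also have "\<dots> = P 1 ** anticomm x z + P 2 ** anticomm x z + P 3 ** anticomm x z"
    by (simp add: matrix_add_rdistrib)
  also have "\<dots> = (\<Sum>i\<in>{1,2,3}. weight i x z *k P i)"
    by (simp add: P_times_anticomm)
  finally show ?thesis .
qed

lemma weight_linear:
  "weight i x (y + z) = weight i x y + weight i x z"
  "weight i x (k *s z) = k * weight i x z"
  by (simp_all add: weight_def anticomm_def M_add M_scale matrix_add_ldistrib matrix_add_rdistrib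
      matrix_scalar_left matrix_scalar_right trace_add trace_scalar add_divide_distrib algebra_simps)

lemma weight_diff: "weight i x (y - z) = weight i x y - weight i x z"
proof -
  have "y - z = y + (-1) *s z" by (simp add: vec_eq_iff)
  then show ?thesis by (simp only: weight_linear) simp
qed

text \<open>The weight sees only the component of \<open>z\<close> in the eigenplane of
  \<open>lam i\<close>, because \<open>P i\<close> can be moved out of \<open>M (P i *v z)\<close>
  and absorbed by the outer \<open>P i\<close>.\<close>

lemma weight_P:
  assumes i: "i \<in> {1,2,3}"
  shows "weight i x (P i *v z) = weight i x z"
proof -
  have PP: "P i ** P i = P i" using P_mult_P[OF i i] by simp
  have "P i ** anticomm x (P i *v z) = P i ** (P i ** M z ** M x) + P i ** ((M x ** P i) ** M z)"
    by (simp add: anticomm_def M_P matrix_add_ldistrib matrix_mul_assoc)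
  also have "\<dots> = (P i ** P i) ** (M z ** M x) + (P i ** P i) ** (M x ** M z)"
    unfolding P_comm[OF M_C] by (simp only: matrix_mul_assoc)
  also have "\<dots> = P i ** anticomm x z"
    unfolding PP by (simp add: anticomm_def matrix_add_ldistrib)
  finally show ?thesis unfolding weight_def by simp
qed

lemma P_times_M_sq:
  assumes i: "i \<in> {1,2,3}"
  shows "P i ** (M x ** M x) = (trace (P i ** (M x ** M x)) / 2) *k P i"
proof -
  let ?X = "P i ** (M x ** M x)"
  have X: "P i ** anticomm x x = 2 *k ?X"
    unfolding anticomm_def matrix_add_ldistrib by (simp add: vec_eq_iff scalar_matrix_mult_def)
  have "weight i x x = trace ?X" unfolding weight_def X trace_scalar by simp
  with P_times_anticomm[OF i, of x x] X have "2 *k ?X = trace ?X *k P i" by argo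
  then have "(1/2) *k (2 *k ?X) = (1/2) *k (trace ?X *k P i)" by simp
  then show ?thesis by (simp add: scalar_matrix_simps)
qed

lemma M_sq: "M x ** M x = (\<Sum>i\<in>{1,2,3}. (trace (P i ** (M x ** M x)) / 2) *k P i)"
proof -
  have "M x ** M x = (\<Sum>i\<in>{1,2,3}. P i) ** (M x ** M x)" unfolding sum_P by simp
  also have "\<dots> = P 1 ** (M x ** M x) + P 2 ** (M x ** M x) + P 3 ** (M x ** M x)"
    by (simp add: matrix_add_rdistrib)
  also have "\<dots> = (\<Sum>i\<in>{1,2,3}. (trace (P i ** (M x ** M x)) / 2) *k P i)"
    using P_times_M_sq[of 1 x] P_times_M_sq[of 2 x] P_times_M_sq[of 3 x] by simp
  finally show ?thesis .
qed

text \<open>The square is a combination of the \<open>P i\<close>, which are polynomials in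
  \<open>C\<close> and so commute with every \<open>M y\<close>. The matrices \<open>M x\<close> and
  \<open>M y\<close> themselves need not commute.\<close>

lemma M_sq_commute: "(M x ** M x) ** M y = M y ** (M x ** M x)"
  by (subst (1 2) M_sq)
    (simp add: matrix_add_ldistrib matrix_add_rdistrib matrix_scalar_left matrix_scalar_right P_comm[OF M_C])

text \<open>As \<open>W *v z\<close> is a combination of \<open>p\<close> and \<open>q\<close>, each
  of \<open>u\<close>, \<open>v\<close>, \<open>w\<close> enters only through its two pairings with
  \<open>p\<close> and \<open>q\<close>, and the weight only through its values at \<open>p\<close>
  and \<open>q\<close>. The claim is the Pluecker relation for these four vectors in a
  plane.\<close>

lemma jacobi_rank_two:
  fixes W :: "complex^6^6"
  assumes W: "\<And>r s. W $ r $ s = p $ r * q $ s - q $ r * p $ s"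
  shows "weight i x (W *v u) * cdot v (W *v w) + weight i x (W *v v) * cdot w (W *v u)
    + weight i x (W *v w) * cdot u (W *v v) = 0"
proof -
  have Wv: "W *v z = cdot q z *s p - cdot p z *s q" for z
    by (simp add: vec_eq_iff matrix_vector_mult_def W cdot_def algebra_simps sum_subtractf sum_distrib_left)
  have wW: "weight i x (W *v z) = cdot q z * weight i x p - cdot p z * weight i x q" for z
    by (simp only: Wv weight_diff weight_linear)
  have cW: "cdot y (W *v z) = cdot q z * cdot p y - cdot p z * cdot q y" for y z
    by (simp only: Wv cdot_simps cdot_commute[of y])
  have "(c * k - b * l) * (e * d - f * g) + (g * k - d * l) * (c * f - b * e) + (e * k - f * l) * (g * b - d * c) = 0"
    for b c d e f g k l :: complex
    by (simp add: algebra_simps)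
  then show ?thesis unfolding wW cW .
qed

text \<open>\<open>N\<close> is the complexified Poisson tensor at \<open>x\<close> for
  \<open>e = \<epsilon>\<^sup>2\<close>, and \<open>T y\<close> its derivative in direction
  \<open>y\<close>. Splitting \<open>T\<close> along the projections separates the cyclic sum into
  three sums, one for each rank-two matrix \<open>P i ** J\<close>, with the common factors
  \<open>\<phi> i\<close>.\<close>

lemma jacobi:
  fixes e :: complex and x u v w :: "complex^6"
  defines "T \<equiv> \<lambda>y. - (e *k (anticomm x y ** J))" and "N \<equiv> J - e *k (M x ** M x ** J)"
  shows "cdot v (T (N *v u) *v w) + cdot w (T (N *v v) *v u) + cdot u (T (N *v w) *v v) = 0"
proof -
  \<comment> \<open>On the eigenplane of \<open>lam i\<close> the square \<open>M x ** M x\<close>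
    is a scalar, so there \<open>N\<close> differs from \<open>J\<close> only by the factor
    \<open>\<phi> i\<close>.\<close>
  define \<phi> where "\<phi> i = 1 - e * (trace (P i ** (M x ** M x)) / 2)" for i
  have PN: "P i ** N = \<phi> i *k (P i ** J)" if "i \<in> {1,2,3}" for i
  proof -
    have "P i ** N = P i ** J - e *k (P i ** (M x ** M x) ** J)"
      unfolding N_def by (simp add: matrix_diff_ldistrib matrix_scalar_right matrix_mul_assoc)
    also have "\<dots> = \<phi> i *k (P i ** J)"
      by (subst P_times_M_sq[OF that])
        (simp add: \<phi>_def matrix_scalar_left scalar_matrix_simps)
    finally show ?thesis .
  qed
  have wN: "weight i x (N *v z) = \<phi> i * weight i x ((P i ** J) *v z)" if "i \<in> {1,2,3}" for i z
  proof -
    have "weight i x (N *v z) = weight i x ((P i ** N) *v z)"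
      using weight_P[OF that, of x "N *v z"] by (simp add: matrix_vector_mul_assoc)
    then show ?thesis by (simp add: PN[OF that] scalar_matrix_vector weight_linear)
  qed
  have T0: "cdot v (T y *v w) = - e * (\<Sum>i\<in>{1,2,3}. weight i x y * cdot v ((P i ** J) *v w))" for y v w
    unfolding T_def anticomm_eq
    by (simp add: matrix_add_rdistrib matrix_scalar_left matrix_vector_minus scalar_matrix_vector
        matrix_vector_mult_add_rdistrib cdot_simps distrib_left mult.assoc)
  have T: "cdot v (T (N *v u) *v w) =
      - e * (\<Sum>i\<in>{1,2,3}. \<phi> i * (weight i x ((P i ** J) *v u) * cdot v ((P i ** J) *v w)))" for u v w
    unfolding T0 by (rule arg_cong[where f = "\<lambda>s. - e * s"], rule sum.cong[OF refl]) (simp only: wN mult.assoc)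
  define F where "F i = weight i x ((P i ** J) *v u) * cdot v ((P i ** J) *v w)
      + weight i x ((P i ** J) *v v) * cdot w ((P i ** J) *v u)
      + weight i x ((P i ** J) *v w) * cdot u ((P i ** J) *v v)" for i
  have F: "F i = 0" if i: "i \<in> {1,2,3}" for i
  proof -
    obtain p q where "\<And>r s. (P i ** J) $ r $ s = p $ r * q $ s - q $ r * p $ s"
      using PJ_rank_two[OF i] by blast
    then show ?thesis unfolding F_def by (rule jacobi_rank_two)
  qed
  have "(\<Sum>i\<in>{1,2,3}. \<phi> i * F i) = 0"
    by (rule sum.neutral) (simp add: F)
  then have "- e * (\<Sum>i\<in>{1,2,3}. \<phi> i * F i) = 0" by simp
  then show ?thesis unfolding T distrib_left[symmetric] sum.distrib[symmetric] F_def .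
qed

end

section \<open>Complexification\<close>

definition cvec :: "real^'n \<Rightarrow> complex^'n"
  where "cvec x = (\<chi> i. complex_of_real (x $ i))"

lemma cmat_simps:
  "cmat (A + B) = cmat A + cmat B" "cmat (A - B) = cmat A - cmat B" "cmat (- A) = - cmat A"
  "cmat (r *\<^sub>R A) = of_real r *k cmat A" "cmat (transpose A) = transpose (cmat A)"
  by (simp_all add: cmat_def vec_eq_iff scalar_matrix_mult_def transpose_def)

lemma cmat_mult: "cmat (A ** B) = cmat A ** cmat B"
  by (simp add: cmat_def vec_eq_iff matrix_matrix_mult_def)

lemma cmat_mat: "cmat (mat r) = mat (of_real r)"
  by (simp add: cmat_def vec_eq_iff mat_def)

lemma cmat_inject: "cmat A = cmat B \<longleftrightarrow> A = B"
  by (simp add: cmat_def vec_eq_iff)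

lemma cmat_mult_cvec: "cmat A *v cvec x = cvec (A *v x)"
  by (simp add: cmat_def cvec_def vec_eq_iff matrix_vector_mult_def)

lemma cdot_cvec: "cdot (cvec x) (cvec y) = of_real (x \<bullet> y)"
  by (simp add: cdot_def cvec_def inner_vec_def)

lemma trace_cmat: "trace (cmat A) = of_real (trace A)"
  by (simp add: trace_def cmat_def)

text \<open>The complex-linear extension of a real-linear matrix-valued \<open>F\<close>, built from
  its values at the standard basis.\<close>

definition cext :: "(real^'n \<Rightarrow> real^'m^'k) \<Rightarrow> complex^'n \<Rightarrow> complex^'m^'k"
  where "cext F z = (\<chi> i j. \<Sum>l\<in>UNIV. z $ l * of_real (F (axis l 1) $ i $ j))"

lemma cext_cvec:
  assumes "linear F"
  shows "cext F (cvec x) = cmat (F x)"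
proof -
  have "F x = F (\<Sum>l\<in>UNIV. x $ l *\<^sub>R axis l 1)"
    by (simp add: basis_expansion scalar_mult_eq_scaleR[symmetric])
  also have "\<dots> = (\<Sum>l\<in>UNIV. x $ l *\<^sub>R F (axis l 1))"
    using assms by (simp add: linear_sum linear_cmul)
  finally show ?thesis by (simp add: cext_def cvec_def cmat_def vec_eq_iff)
qed

lemma cext_mult_left: "cmat A ** cext F z = cext (\<lambda>x. A ** F x) z"
  unfolding cext_def cmat_def matrix_matrix_mult_def
  by (simp add: vec_eq_iff sum_distrib_left mult_ac, subst sum.swap, simp)

lemma cext_mult_right: "cext F z ** cmat A = cext (\<lambda>x. F x ** A) z"
  unfolding cext_def cmat_def matrix_matrix_mult_def
  by (simp add: vec_eq_iff sum_distrib_left sum_distrib_right mult_ac, subst sum.swap, simp)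

lemma cext_transpose: "transpose (cext F z) = cext (\<lambda>x. transpose (F x)) z"
  by (simp add: cext_def transpose_def vec_eq_iff)

lemma cext_swap:
  assumes "\<And>x y. F x *v y = F y *v x"
  shows "cext F z *v y = cext F y *v z"
proof -
  have F: "F (axis l 1) $ i $ j = F (axis j 1) $ i $ l" for i j l
    using arg_cong[OF assms[of "axis l 1" "axis j 1"], of "\<lambda>v. v $ i"]
    by (simp add: matrix_vector_mult_basis column_def)
  have "(cext F z *v y) $ i = (cext F y *v z) $ i" for i
  proof -
    have "(cext F z *v y) $ i = (\<Sum>j\<in>UNIV. \<Sum>l\<in>UNIV. z $ l * of_real (F (axis l 1) $ i $ j) * y $ j)"
      by (simp add: cext_def matrix_vector_mult_def sum_distrib_right)
    also have "\<dots> = (\<Sum>l\<in>UNIV. \<Sum>j\<in>UNIV. z $ l * of_real (F (axis l 1) $ i $ j) * y $ j)"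
      by (rule sum.swap)
    also have "\<dots> = (\<Sum>l\<in>UNIV. \<Sum>j\<in>UNIV. y $ j * of_real (F (axis j 1) $ i $ l) * z $ l)"
      by (intro sum.cong refl) (subst F, simp)
    also have "\<dots> = (cext F y *v z) $ i"
      by (simp add: cext_def matrix_vector_mult_def sum_distrib_right)
    finally show ?thesis .
  qed
  then show ?thesis by (simp add: vec_eq_iff)
qed

section \<open>Poisson property of Kahan maps\<close>

lemma bounded_bilinear_matrix_matrix_mult:
  "bounded_bilinear (\<lambda>(A::real^'n^'m) (B::real^'k^'n). A ** B)"
  by (rule bilinear_conv_bounded_bilinear[THEN iffD1])
    (auto simp: bilinear_def matrix_add_ldistrib matrix_add_rdistrib matrix_scaleR_left matrix_scaleR_right
      intro!: linearI)

text \<open>Multiplying the claim by \<open>mat 1 - U\<close> and its transpose replaces the Jacobi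
  matrix of the Kahan map by \<open>mat 1 + V\<close>. Moving \<open>J\<close> to the right by
  \<open>ham\<close> reduces everything to \<open>poly\<close>, whose sides agree because
  \<open>U ** U\<close> commutes with \<open>V\<close> and \<open>V ** V\<close> with
  \<open>U\<close>. Only the square of \<open>N\<close> enters \<open>Q\<close>, so fields with the
  same square share the tensor.\<close>

lemma kahan_poisson_map:
  fixes N :: "real^'n \<Rightarrow> real^'n^'n" and J :: "real^'n^'n"
  assumes lin: "linear N" and swap: "\<And>x y. N x *v y = N y *v x"
    and Jac: "\<And>x. Jac h x = N x" and ham: "\<And>x. J ** transpose (N x) = - (N x ** J)"
    and comm: "\<And>x y. (N x ** N x) ** N y = N y ** (N x ** N x)"
    and Q: "\<And>x. Q x = J - \<epsilon>\<^sup>2 *\<^sub>R (N x ** N x ** J)"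
    and inv: "invertible (mat 1 - \<epsilon> *\<^sub>R Jac h x)"
  shows "Jac (kahan \<epsilon> h) x ** Q x ** transpose (Jac (kahan \<epsilon> h) x) = Q (kahan \<epsilon> h x)"
proof -
  define D where "D = Jac (kahan \<epsilon> h) x"
  define x' where "x' = kahan \<epsilon> h x"
  define U where "U = \<epsilon> *\<^sub>R N x"
  define V where "V = \<epsilon> *\<^sub>R N x'"
  have LD: "(mat 1 - U) ** D = mat 1 + V"
    using Jac_kahan[OF lin swap Jac inv[unfolded Jac]] unfolding U_def V_def D_def x'_def .
  have PU: "Q x = J - U ** U ** J" and PV: "Q x' = J - V ** V ** J"
    unfolding Q U_def V_def by (simp_all add: matrix_scaleR_left matrix_scaleR_right power2_eq_square)
  have ts: "transpose (r *\<^sub>R X) = r *\<^sub>R transpose X" for r and X :: "real^'n^'n"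
    by (simp add: transpose_def vec_eq_iff)
  have JU: "J ** transpose U = - (U ** J)" and JV: "J ** transpose V = - (V ** J)"
    unfolding U_def V_def ts by (simp_all add: matrix_scaleR_left matrix_scaleR_right ham)
  have c1: "V ** U ** U = U ** U ** V" and c2: "V ** V ** U = U ** V ** V"
    using comm[of x x'] comm[of x' x] unfolding U_def V_def
    by (simp_all add: matrix_scaleR_left matrix_scaleR_right matrix_mul_assoc)
  have c3: "U ** V ** V ** U = U ** U ** V ** V"
  proof -
    have "U ** V ** V ** U = U ** (V ** V ** U)" by (simp only: matrix_mul_assoc)
    then show ?thesis unfolding c2 by (simp only: matrix_mul_assoc)
  qed
  have JtV: "J ** transpose (mat 1 + V) = (mat 1 - V) ** J"
    by (simp add: transpose_simps matrix_add_ldistrib matrix_diff_rdistrib JV)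
  have JtU: "J ** transpose (mat 1 - U) = (mat 1 + U) ** J"
    by (simp add: transpose_simps matrix_diff_ldistrib matrix_add_rdistrib JU)
  have poly: "(mat 1 + V) ** (mat 1 - U ** U) ** (mat 1 - V) = (mat 1 - U) ** (mat 1 - V ** V) ** (mat 1 + U)"
    by (simp add: matrix_add_ldistrib matrix_add_rdistrib matrix_diff_ldistrib matrix_diff_rdistrib
        matrix_mul_assoc c1 c2 c3)
  let ?L = "mat 1 - U"
  have "?L ** (D ** Q x ** transpose D) ** transpose ?L = (?L ** D) ** Q x ** transpose (?L ** D)"
    by (simp add: matrix_transpose_mul matrix_mul_assoc)
  also have "\<dots> = (mat 1 + V) ** (mat 1 - U ** U) ** (J ** transpose (mat 1 + V))"
    unfolding LD PU by (simp add: matrix_mul_assoc matrix_diff_rdistrib matrix_diff_ldistrib)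
  also have "\<dots> = (mat 1 + V) ** (mat 1 - U ** U) ** (mat 1 - V) ** J"
    unfolding JtV by (simp only: matrix_mul_assoc)
  also have "\<dots> = ?L ** (mat 1 - V ** V) ** (J ** transpose ?L)"
    unfolding poly JtU by (simp only: matrix_mul_assoc)
  also have "\<dots> = ?L ** Q x' ** transpose ?L"
    unfolding PV by (simp add: matrix_mul_assoc matrix_diff_rdistrib matrix_diff_ldistrib)
  finally have eq: "?L ** (D ** Q x ** transpose D) ** transpose ?L = ?L ** Q x' ** transpose ?L" .
  have "invertible ?L" using inv unfolding Jac U_def .
  then obtain L' where L': "L' ** ?L = mat 1" unfolding invertible_def by blast
  then have L'': "transpose ?L ** transpose L' = mat 1"
    by (metis matrix_transpose_mul transpose_mat)
  have "L' ** (?L ** X ** transpose ?L) ** transpose L' = X" for X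
  proof -
    have "L' ** (?L ** X ** transpose ?L) ** transpose L' = (L' ** ?L) ** X ** (transpose ?L ** transpose L')"
      by (simp only: matrix_mul_assoc)
    then show ?thesis unfolding L' L'' by simp
  qed
  then have "D ** Q x ** transpose D = Q x'" using eq by metis
  then show ?thesis unfolding D_def x'_def .
qed

text \<open>The eigenvalues of \<open>A\<close> may be non-real, so \<open>B i\<close>,
  \<open>q i\<close> and the coefficients are complex and (i) is an identity of complexified
  matrices; (ii) to (iv) are real. The Kahan maps are considered at points where their defining
  matrix is invertible.\<close>

theorem mainTheorem12:
  fixes A :: "real^6^6" and H0 :: "real^6 \<Rightarrow> real" and \<epsilon> :: real
    and lam alpha beta gamma :: "nat \<Rightarrow> complex"
    and f :: "real^6 \<Rightarrow> real^6" and PP :: "real^6 \<Rightarrow> real^6^6"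
    and Ac :: "complex^6^6" and B :: "nat \<Rightarrow> complex^6^6"
    and p0 :: "real^6 \<Rightarrow> real" and q :: "nat \<Rightarrow> real^6 \<Rightarrow> complex"
  assumes f_def: "f = (\<lambda>x. Jmat *v grad H0 x)"
    and PP_def: "PP = (\<lambda>x. Jmat - \<epsilon>\<^sup>2 *\<^sub>R (Jac f x ** Jac f x ** Jmat))"
    and Ac_def: "Ac = cmat A"
    and B_def: "B = (\<lambda>i. mat (alpha i) + mat (beta i) ** Ac + mat (gamma i) ** (Ac ** Ac))"
    and p0_def: "p0 = (\<lambda>x. (1/8) * trace (Jac f x ** Jac f x))"
    and q_def: "q = (\<lambda>i x. (1/8) * trace (transpose (B i) ** (cmat (Jac f x) ** cmat (Jac f x))))"
    and skewH: "skew_hamiltonian A"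
    and cubic: "cubic_form H0"
    and comm: "\<forall>x. A ** hess H0 x = hess H0 x ** transpose A"
    and distinct: "lam 1 \<noteq> lam 2" "lam 1 \<noteq> lam 3" "lam 2 \<noteq> lam 3"
    and charpoly: "\<forall>t::complex. det (mat t - Ac) = ((t - lam 1) * (t - lam 2) * (t - lam 3))\<^sup>2"
    and interp: "\<forall>i\<in>{1,2,3}. \<forall>j\<in>{1,2,3}.
                   alpha i + beta i * lam j + gamma i * (lam j)\<^sup>2 = (if i = j then -1 else 1)"
    and nondeg: "\<exists>x. det (Jac f x) \<noteq> 0"
  shows
    "(\<forall>x. cmat (PP x) =
           mat (1 - of_real (\<epsilon>\<^sup>2 * p0 x)) ** cmat Jmat
           - mat (of_real (\<epsilon>\<^sup>2)) ** (\<Sum>i\<in>{1,2,3}. mat (q i x) ** transpose (B i) ** cmat Jmat)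
       \<and> cmat (PP x) =
           mat (1 - of_real (\<epsilon>\<^sup>2) * (of_real (p0 x) + (\<Sum>i\<in>{1,2,3}. alpha i * q i x))) ** cmat Jmat
           - mat (of_real (\<epsilon>\<^sup>2) * (\<Sum>i\<in>{1,2,3}. beta i * q i x)) ** transpose Ac ** cmat Jmat
           - mat (of_real (\<epsilon>\<^sup>2) * (\<Sum>i\<in>{1,2,3}. gamma i * q i x))
               ** (transpose Ac ** transpose Ac) ** cmat Jmat)
     \<and> poisson_tensor PP
     \<and> (\<forall>x. invertible (mat 1 - \<epsilon> *\<^sub>R Jac f x) \<longrightarrow>
           Jac (kahan \<epsilon> f) x ** PP x ** transpose (Jac (kahan \<epsilon> f) x) = PP (kahan \<epsilon> f x))
     \<and> (\<forall>a b c :: real. (mat a + b *\<^sub>R A + c *\<^sub>R (A ** A)) ** (mat a + b *\<^sub>R A + c *\<^sub>R (A ** A)) = mat 1 \<longrightarrow>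
          (let g = (\<lambda>x. transpose (mat a + b *\<^sub>R A + c *\<^sub>R (A ** A)) *v f x) in
           \<forall>x. invertible (mat 1 - \<epsilon> *\<^sub>R Jac g x) \<longrightarrow>
             Jac (kahan \<epsilon> g) x ** PP x ** transpose (Jac (kahan \<epsilon> g) x) = PP (kahan \<epsilon> g x)))"
proof -
  from cubic obtain S where linS: "linear S" and symS: "\<And>x. transpose (S x) = S x"
    and swapS: "\<And>x y. S x *v y = S y *v x"
    and gradH: "\<And>x. (grad H0 has_derivative (\<lambda>h. S x *v h)) (at x)"
    by (rule cubic_form_hess) blast
  have AS: "A ** S x = S x ** transpose A" for x
    using comm Jac_eqI[OF gradH] unfolding hess_def by simp
  have AJ: "transpose A ** Jmat = Jmat ** A" using skewH unfolding skew_hamiltonian_def .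
  define M where "M x = Jmat ** S x" for x
  have linM: "linear M"
    unfolding M_def using linS
    by (intro linearI) (simp_all add: linear_add linear_cmul matrix_add_ldistrib matrix_scaleR_right)
  have swapM: "M x *v y = M y *v x" for x y
    unfolding M_def by (simp add: matrix_vector_mul_assoc[symmetric] swapS[of x])
  have derf: "(f has_derivative (\<lambda>h. M x *v h)) (at x)" for x
    unfolding f_def M_def matrix_vector_mul_assoc[symmetric]
    by (rule bounded_linear.has_derivative[OF matrix_vector_mul_bounded_linear gradH])
  have Jacf: "Jac f x = M x" for x by (rule Jac_eqI) (rule derf)
  have MC: "M x ** transpose A = transpose A ** M x" for x
  proof -
    have "transpose A ** M x = Jmat ** (A ** S x)" unfolding M_def by (simp only: matrix_mul_assoc AJ)
    then show ?thesis unfolding AS M_def by (simp only: matrix_mul_assoc)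
  qed
  have ham: "Jmat ** transpose (M x) = - (M x ** Jmat)" for x
    unfolding M_def by (simp add: matrix_transpose_mul symS transpose_Jmat matrix_minus_right matrix_mul_assoc)

  define C where "C = transpose Ac"
  have C: "C = cmat (transpose A)" unfolding C_def Ac_def by (simp only: cmat_simps)
  \<comment> \<open>This is half of \<open>mat 1 - transpose (B i)\<close>: the polynomial of
    \<open>B i\<close> is -1 at \<open>lam i\<close> and 1 at the other eigenvalues, so half of one
    minus it is the indicator of \<open>lam i\<close>.\<close>
  define P where "P i = ((1 - alpha i) / 2) *k mat 1 + (- beta i / 2) *k C + (- gamma i / 2) *k (C ** C)" for i
  interpret cubic_splitting "cmat Jmat" C lam "\<lambda>i. (1 - alpha i) / 2" "\<lambda>i. - beta i / 2"
    "\<lambda>i. - gamma i / 2" P "cext S" "cext M"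
  proof
    show "transpose (cmat Jmat) = - cmat Jmat"
      by (simp only: cmat_simps(5)[symmetric] transpose_Jmat cmat_simps(3))
    show "cmat Jmat ** cmat Jmat = - mat 1"
      by (simp only: cmat_mult[symmetric] Jmat_squared cmat_simps(3) cmat_mat of_real_1)
    have "transpose (transpose A ** Jmat) = - (transpose A ** Jmat)"
      unfolding AJ by (simp add: matrix_transpose_mul transpose_Jmat matrix_minus_right AJ)
    then show "transpose (C ** cmat Jmat) = - (C ** cmat Jmat)"
      unfolding C by (simp only: cmat_mult[symmetric] cmat_simps(5)[symmetric] cmat_simps(3)[symmetric])
    show "det (mat (lam i) - C) = 0" if "i \<in> {1,2,3}" for i
    proof -
      have "mat (lam i) - C = transpose (mat (lam i) - Ac)"
        unfolding C_def by (simp add: transpose_simps)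
      then have "det (mat (lam i) - C) = det (mat (lam i) - Ac)" by (simp only: det_transpose)
      then show ?thesis using charpoly that by auto
    qed
    show "(1 - alpha i) / 2 + - beta i / 2 * lam j + - gamma i / 2 * (lam j)\<^sup>2 = (if i = j then 1 else 0)"
      if "i \<in> {1,2,3}" "j \<in> {1,2,3}" for i j
    proof -
      have "(1 - alpha i) / 2 + - beta i / 2 * lam j + - gamma i / 2 * (lam j)\<^sup>2
          = (1 - (alpha i + beta i * lam j + gamma i * (lam j)\<^sup>2)) / 2"
        by (simp add: field_simps)
      also have "\<dots> = (if i = j then 1 else 0)"
        unfolding interp[THEN bspec, OF that(1), THEN bspec, OF that(2)] by simp
      finally show ?thesis .
    qed
    show "P i = ((1 - alpha i) / 2) *k mat 1 + (- beta i / 2) *k C + (- gamma i / 2) *k (C ** C)" for i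
      by (rule P_def)
    show "cext M z = cmat Jmat ** cext S z" for z
      unfolding cext_mult_left M_def ..
    show "transpose (cext S z) = cext S z" for z
      unfolding cext_transpose symS ..
    show "cext M z *v y = cext M y *v z" for z y
      by (rule cext_swap) (rule swapM)
    show "cext M z ** C = C ** cext M z" for z
      unfolding C cext_mult_left cext_mult_right MC ..
  qed
  have cM: "cext M (cvec x) = cmat (M x)" for x by (rule cext_cvec) (rule linM)
  have M2M: "(M x ** M x) ** M y = M y ** (M x ** M x)" for x y
    using M_sq_commute[of "cvec x" "cvec y"] unfolding cM cmat_mult[symmetric] cmat_inject .
  have PP: "PP x = Jmat - \<epsilon>\<^sup>2 *\<^sub>R (M x ** M x ** Jmat)" for x
    unfolding PP_def Jacf ..
  have cPP: "cmat (PP x) = cmat Jmat - of_real (\<epsilon>\<^sup>2) *k (cmat (M x) ** cmat (M x) ** cmat Jmat)" for x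
    unfolding PP by (simp only: cmat_simps cmat_mult)

  have part1: "cmat (PP x) =
           mat (1 - of_real (\<epsilon>\<^sup>2 * p0 x)) ** cmat Jmat
           - mat (of_real (\<epsilon>\<^sup>2)) ** (\<Sum>i\<in>{1,2,3}. mat (q i x) ** transpose (B i) ** cmat Jmat)
       \<and> cmat (PP x) =
           mat (1 - of_real (\<epsilon>\<^sup>2) * (of_real (p0 x) + (\<Sum>i\<in>{1,2,3}. alpha i * q i x))) ** cmat Jmat
           - mat (of_real (\<epsilon>\<^sup>2) * (\<Sum>i\<in>{1,2,3}. beta i * q i x)) ** transpose Ac ** cmat Jmat
           - mat (of_real (\<epsilon>\<^sup>2) * (\<Sum>i\<in>{1,2,3}. gamma i * q i x))
               ** (transpose Ac ** transpose Ac) ** cmat Jmat" for x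
  proof -
    define X where "X = cmat (M x) ** cmat (M x)"
    \<comment> \<open>The scalar by which \<open>X\<close> acts on the eigenplane of
      \<open>lam i\<close>.\<close>
    define \<mu> where "\<mu> i = trace (P i ** X) / 2" for i
    have X: "X = \<mu> 1 *k P 1 + \<mu> 2 *k P 2 + \<mu> 3 *k P 3"
      using M_sq[of "cvec x"] unfolding cM X_def[symmetric] \<mu>_def[symmetric] by (simp add: add.assoc)
    have one: "mat 1 = P 1 + P 2 + P 3" using sum_P by (simp add: add.assoc)
    have "trace X = trace ((P 1 + P 2 + P 3) ** X)" unfolding one[symmetric] by simp
    also have "\<dots> = 2 * (\<mu> 1 + \<mu> 2 + \<mu> 3)"
      by (simp add: matrix_add_rdistrib trace_add \<mu>_def)
    finally have trX: "trace X = 2 * (\<mu> 1 + \<mu> 2 + \<mu> 3)" .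
    have Bt: "transpose (B i) = alpha i *k mat 1 + beta i *k C + gamma i *k (C ** C)" for i
      unfolding B_def C_def
      by (simp add: transpose_simps mat_mul_left transpose_scalar_mult matrix_transpose_mul mat_eq_scalar[of "alpha i"])
    have BP: "transpose (B i) = mat 1 - 2 *k P i" for i
      unfolding Bt P_def by (simp add: vec_eq_iff scalar_matrix_mult_def field_simps)
    have p0: "of_real (p0 x) = (\<mu> 1 + \<mu> 2 + \<mu> 3) / 4"
      unfolding p0_def Jacf using trX unfolding X_def cmat_mult[symmetric] trace_cmat by simp
    have q: "q i x = (\<mu> 1 + \<mu> 2 + \<mu> 3 - 2 * \<mu> i) / 4" for i
      unfolding q_def Jacf X_def[symmetric] BP
      by (simp add: matrix_diff_rdistrib matrix_scalar_left trace_sub trace_scalar trX \<mu>_def)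
    \<comment> \<open>On the component of \<open>P i\<close> the right-hand side has the coefficient
      \<open>p0 + q 1 + q 2 + q 3 - 2 * q i\<close>; with the values just found this equals
      \<open>\<mu> i\<close>.\<close>
    have XB: "X = of_real (p0 x) *k mat 1 + q 1 x *k transpose (B 1) + q 2 x *k transpose (B 2) + q 3 x *k transpose (B 3)"
      unfolding p0 q BP one X
      by (simp add: vec_eq_iff scalar_matrix_mult_def field_simps)
    have XJ: "X ** cmat Jmat = of_real (p0 x) *k cmat Jmat + q 1 x *k (transpose (B 1) ** cmat Jmat)
        + q 2 x *k (transpose (B 2) ** cmat Jmat) + q 3 x *k (transpose (B 3) ** cmat Jmat)"
      by (subst XB) (simp add: matrix_add_rdistrib matrix_scalar_left)
    have BJ: "transpose (B i) ** cmat Jmat = alpha i *k cmat Jmat + beta i *k (C ** cmat Jmat)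
        + gamma i *k (C ** C ** cmat Jmat)" for i
      unfolding Bt by (simp add: matrix_add_rdistrib matrix_scalar_left)
    show ?thesis
      unfolding cPP X_def[symmetric] XJ C_def[symmetric] mat_mul_left matrix_scalar_left
      unfolding BJ
      by (simp add: vec_eq_iff scalar_matrix_mult_def algebra_simps)
  qed

  have part2: "poisson_tensor PP"
  proof (rule poisson_tensorI)
    show "transpose (PP x) = - PP x" for x
    proof -
      have "transpose (M x ** M x ** Jmat) = - (M x ** M x ** Jmat)"
        unfolding M_def by (simp add: matrix_transpose_mul symS transpose_Jmat matrix_minus_left matrix_minus_right matrix_mul_assoc)
      moreover have "transpose (r *\<^sub>R X) = r *\<^sub>R transpose X" for r and X :: "real^6^6"
        by (simp add: transpose_def vec_eq_iff)
      ultimately show ?thesis unfolding PP by (simp add: transpose_simps transpose_Jmat)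
    qed
    define P' where "P' x v = - (\<epsilon>\<^sup>2 *\<^sub>R ((M v ** M x + M x ** M v) ** Jmat))" for x v
    have derM: "(M has_derivative M) (at x)" for x using linM by (simp add: linear_imp_has_derivative)
    show "(PP has_derivative P' x) (at x)" for x
    proof -
      have "((\<lambda>x. M x ** M x) has_derivative (\<lambda>v. M x ** M v + M v ** M x)) (at x)"
        by (rule bounded_bilinear.FDERIV[OF bounded_bilinear_matrix_matrix_mult derM derM])
      from bounded_bilinear.FDERIV[OF bounded_bilinear_matrix_matrix_mult this has_derivative_const[of Jmat]]
      have "((\<lambda>x. M x ** M x ** Jmat) has_derivative (\<lambda>v. (M v ** M x + M x ** M v) ** Jmat)) (at x)"
        by (simp add: add.commute)
      from has_derivative_diff[OF has_derivative_const[of Jmat] has_derivative_scaleR_right[OF this, of "\<epsilon>\<^sup>2"]]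
      show ?thesis unfolding PP[abs_def] P'_def[abs_def] by simp
    qed
    fix x u v w
    \<comment> \<open>Transfers the real expression to the complex setting, where
      \<open>jacobi\<close> applies with \<open>e = \<epsilon>\<^sup>2\<close>.\<close>
    have cP': "of_real (v \<bullet> (P' x (PP x *v u) *v w)) =
        cdot (cvec v) (- (of_real (\<epsilon>\<^sup>2) *k (anticomm (cvec x)
           ((cmat Jmat - of_real (\<epsilon>\<^sup>2) *k (cext M (cvec x) ** cext M (cvec x) ** cmat Jmat)) *v cvec u) ** cmat Jmat)) *v cvec w)"
      for u v w
      unfolding anticomm_def cM
      unfolding cPP[symmetric]
      unfolding cmat_mult_cvec cM
      unfolding cmat_mult[symmetric] cmat_simps(1,3,4)[symmetric] cmat_mult_cvec cdot_cvec P'_def ..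
    have "of_real (v \<bullet> (P' x (PP x *v u) *v w) + w \<bullet> (P' x (PP x *v v) *v u) + u \<bullet> (P' x (PP x *v w) *v v)) = (0::complex)"
      unfolding of_real_add cP' by (rule jacobi)
    then show "v \<bullet> (P' x (PP x *v u) *v w) + w \<bullet> (P' x (PP x *v v) *v u) + u \<bullet> (P' x (PP x *v w) *v v) = 0"
      by (simp only: of_real_eq_0_iff)
  qed

  have part3: "Jac (kahan \<epsilon> f) x ** PP x ** transpose (Jac (kahan \<epsilon> f) x) = PP (kahan \<epsilon> f x)"
    if "invertible (mat 1 - \<epsilon> *\<^sub>R Jac f x)" for x
    by (rule kahan_poisson_map[OF linM swapM Jacf ham M2M PP that])

  \<comment> \<open>The Jacobi matrix of \<open>g\<close> is
    \<open>N y = transpose K ** M y\<close>. As \<open>transpose K\<close> commutes with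
    \<open>M y\<close> and squares to the identity, \<open>N y\<close> and \<open>M y\<close> have
    the same square, hence the same tensor \<open>PP\<close>; \<open>K\<close> being
    skew-Hamiltonian keeps the relation between \<open>N y\<close> and \<open>Jmat\<close>.\<close>
  have part4: "Jac (kahan \<epsilon> g) x ** PP x ** transpose (Jac (kahan \<epsilon> g) x) = PP (kahan \<epsilon> g x)"
    if K: "K = mat a + b *\<^sub>R A + c *\<^sub>R (A ** A)" and KK: "K ** K = mat 1"
      and g: "g = (\<lambda>x. transpose K *v f x)" and inv: "invertible (mat 1 - \<epsilon> *\<^sub>R Jac g x)"
    for a b c :: real and K g x
  proof -
    let ?K = "transpose K"
    have tK: "?K = mat a + b *\<^sub>R transpose A + c *\<^sub>R (transpose A ** transpose A)"
      unfolding K matrix_transpose_mul[symmetric] by (simp add: vec_eq_iff transpose_def mat_def)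
    have matc: "mat a ** X = X ** mat a" for X :: "real^6^6"
      by (simp add: mat_mul_left) (subst mat_eq_scalar, simp add: matrix_scalar_right)
    have KM: "M y ** ?K = ?K ** M y" for y
      unfolding tK using MC[of y] matrix_commute_mult[OF MC[of y, symmetric] MC[of y, symmetric]]
      by (simp add: matrix_add_ldistrib matrix_add_rdistrib matrix_scaleR_left matrix_scaleR_right matc)
    have JAA: "Jmat ** (A ** A) = (transpose A ** transpose A) ** Jmat"
    proof -
      have "Jmat ** (A ** A) = (transpose A ** Jmat) ** A" unfolding AJ by (simp only: matrix_mul_assoc)
      also have "\<dots> = transpose A ** (Jmat ** A)" by (simp only: matrix_mul_assoc)
      finally show ?thesis unfolding AJ[symmetric] by (simp only: matrix_mul_assoc)
    qed
    have JK: "Jmat ** K = ?K ** Jmat"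
      unfolding tK unfolding K by (simp add: matrix_add_ldistrib matrix_add_rdistrib matrix_scaleR_left matrix_scaleR_right matc AJ JAA)
    have tKK: "?K ** ?K = mat 1"
      using arg_cong[OF KK, of transpose] by (simp add: matrix_transpose_mul)
    define N where "N y = ?K ** M y" for y
    have linN: "linear N" unfolding N_def using linM
      by (intro linearI) (simp_all add: linear_add linear_cmul matrix_add_ldistrib matrix_scaleR_right)
    have swapN: "N y *v z = N z *v y" for y z
      unfolding N_def matrix_vector_mul_assoc[symmetric] swapM[of y] ..
    have JacN: "Jac g y = N y" for y
      unfolding g N_def
      by (rule Jac_eqI, unfold matrix_vector_mul_assoc[symmetric])
        (rule bounded_linear.has_derivative[OF matrix_vector_mul_bounded_linear derf])
    have hamN: "Jmat ** transpose (N y) = - (N y ** Jmat)" for y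
    proof -
      have "Jmat ** transpose (N y) = (Jmat ** transpose (M y)) ** K"
        unfolding N_def by (simp add: matrix_transpose_mul matrix_mul_assoc)
      also have "\<dots> = - (M y ** (Jmat ** K))" unfolding ham by (simp add: matrix_minus_left matrix_mul_assoc)
      also have "\<dots> = - (M y ** ?K ** Jmat)" unfolding JK by (simp only: matrix_mul_assoc)
      finally show ?thesis unfolding KM N_def .
    qed
    have NN: "N y ** N y = M y ** M y" for y
    proof -
      have "N y ** N y = ?K ** (M y ** ?K) ** M y" unfolding N_def by (simp only: matrix_mul_assoc)
      also have "\<dots> = (?K ** ?K) ** (M y ** M y)" unfolding KM by (simp only: matrix_mul_assoc)
      finally show ?thesis unfolding tKK by simp
    qed
    have commN: "(N y ** N y) ** N z = N z ** (N y ** N y)" for y z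
    proof -
      have "?K ** (M y ** M y) = (M y ** M y) ** ?K" using matrix_commute_mult[OF KM KM, of y y] by simp
      from matrix_commute_mult[OF this M2M[symmetric], of z] show ?thesis unfolding NN unfolding N_def by simp
    qed
    show ?thesis
      by (rule kahan_poisson_map[OF linN swapN JacN hamN commN _ inv]) (simp only: PP NN)
  qed
  show ?thesis
    unfolding Let_def
    by (intro conjI allI impI part2 part3 part4[OF refl _ refl] part1[THEN conjunct1] part1[THEN conjunct2])
qed

end
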